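(* Let $H$ be a connected triangle-free graph with no full star-cutset, and let $H^*$ be a subdivision of $H$. Then $H^*$ is a restricted frame graph if and only if $H$ is either a path on at most $4$ vertices or a luxury chandelier.
   Context: A frame is the boundary of an axis-parallel box $I\times J\subset\mathbb R^2$ ($I,J$ intervals). A graph $G$ is a restricted frame graph if there is a family of frames $\{F_v : v\in V(G)\}$ with $uv\in E(G)$ iff $F_u\cap F_v\neq\emptyset$, satisfying: (1) corners of a frame do not coincide with any point of another frame; (2) the left side of any frame does not intersect any other frame; (3) if the right side of a frame intersects a second frame, this right side intersects both the top and the bottom side of the second frame; (4) if two frames have non-empty intersection, then no frame is entirely contained in the intersection of the two closed regions bounded by these two frames. A full star-cutset of a connected graph $G$ is a set $N[u]=\{u\}\cup N(u)$ whose removal disconnects $G$. A chandelier is a graph obtained from a tree $T$ by adding a new vertex (the pivot) adjacent to every leaf of $T$; it is a luxury chandelier if in $T$ the neighbor of each leaf has degree two. A subdivision of a graph is obtained by replacing edges by paths (each edge by a path with at least one edge). *)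

theory Defs
  imports Complex_Main
begin

definition graph :: "'a set \<Rightarrow> 'a set set \<Rightarrow> bool" where
  "graph V E \<longleftrightarrow> finite V \<and> (\<forall>e\<in>E. \<exists>u v. u \<in> V \<and> v \<in> V \<and> u \<noteq> v \<and> e = {u, v})"

definition adj :: "'a set set \<Rightarrow> 'a \<Rightarrow> 'a \<Rightarrow> bool" where
  "adj E u v \<longleftrightarrow> {u, v} \<in> E \<and> u \<noteq> v"

definition nbhd :: "'a set \<Rightarrow> 'a set set \<Rightarrow> 'a \<Rightarrow> 'a set" where
  "nbhd V E u = {v \<in> V. adj E u v}"

definition closed_nbhd :: "'a set \<Rightarrow> 'a set set \<Rightarrow> 'a \<Rightarrow> 'a set" where
  "closed_nbhd V E u = insert u (nbhd V E u)"

definition degree :: "'a set \<Rightarrow> 'a set set \<Rightarrow> 'a \<Rightarrow> nat" where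
  "degree V E u = card (nbhd V E u)"

definition reachable :: "'a set \<Rightarrow> 'a set set \<Rightarrow> 'a \<Rightarrow> 'a \<Rightarrow> bool" where
  "reachable V E u v \<longleftrightarrow> (\<lambda>x y. x \<in> V \<and> y \<in> V \<and> adj E x y)\<^sup>*\<^sup>* u v"

definition connected_graph :: "'a set \<Rightarrow> 'a set set \<Rightarrow> bool" where
  "connected_graph V E \<longleftrightarrow> V \<noteq> {} \<and> (\<forall>u\<in>V. \<forall>v\<in>V. reachable V E u v)"

definition del_verts :: "'a set \<Rightarrow> 'a set set \<Rightarrow> 'a set \<Rightarrow> 'a set \<times> 'a set set" where
  "del_verts V E S = (V - S, {e \<in> E. e \<inter> S = {}})"

definition disconnects :: "'a set \<Rightarrow> 'a set set \<Rightarrow> 'a set \<Rightarrow> bool" where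
  "disconnects V E S \<longleftrightarrow>
     (\<exists>x\<in>V - S. \<exists>y\<in>V - S. \<not> reachable (V - S) {e \<in> E. e \<inter> S = {}} x y)"

definition has_full_star_cutset :: "'a set \<Rightarrow> 'a set set \<Rightarrow> bool" where
  "has_full_star_cutset V E \<longleftrightarrow> (\<exists>u\<in>V. disconnects V E (closed_nbhd V E u))"

definition triangle_free :: "'a set \<Rightarrow> 'a set set \<Rightarrow> bool" where
  "triangle_free V E \<longleftrightarrow>
     \<not> (\<exists>x\<in>V. \<exists>y\<in>V. \<exists>z\<in>V. adj E x y \<and> adj E y z \<and> adj E x z)"

definition list_edges :: "'a list \<Rightarrow> 'a set set" where
  "list_edges xs = set (map (\<lambda>(a, b). {a, b}) (zip xs (tl xs)))"

definition is_path_graph :: "'a set \<Rightarrow> 'a set set \<Rightarrow> bool" where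
  "is_path_graph V E \<longleftrightarrow>
     (\<exists>xs. xs \<noteq> [] \<and> distinct xs \<and> set xs = V \<and> E = list_edges xs)"

definition has_cycle :: "'a set \<Rightarrow> 'a set set \<Rightarrow> bool" where
  "has_cycle V E \<longleftrightarrow>
     (\<exists>xs. length xs \<ge> 3 \<and> distinct xs \<and> set xs \<subseteq> V \<and>
           (\<forall>i. Suc i < length xs \<longrightarrow> adj E (xs ! i) (xs ! Suc i)) \<and>
           adj E (last xs) (hd xs))"

definition is_tree :: "'a set \<Rightarrow> 'a set set \<Rightarrow> bool" where
  "is_tree V E \<longleftrightarrow> graph V E \<and> connected_graph V E \<and> \<not> has_cycle V E"

definition leaves :: "'a set \<Rightarrow> 'a set set \<Rightarrow> 'a set" where
  "leaves V E = {v \<in> V. degree V E v = 1}"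

definition chandelier_pivot :: "'a set \<Rightarrow> 'a set set \<Rightarrow> 'a \<Rightarrow> bool" where
  "chandelier_pivot V E p \<longleftrightarrow> p \<in> V \<and>
     is_tree (V - {p}) {e \<in> E. p \<notin> e} \<and>
     nbhd V E p = leaves (V - {p}) {e \<in> E. p \<notin> e}"

definition chandelier :: "'a set \<Rightarrow> 'a set set \<Rightarrow> bool" where
  "chandelier V E \<longleftrightarrow> graph V E \<and> (\<exists>p. chandelier_pivot V E p)"

definition luxury_chandelier :: "'a set \<Rightarrow> 'a set set \<Rightarrow> bool" where
  "luxury_chandelier V E \<longleftrightarrow> graph V E \<and>
     (\<exists>p. chandelier_pivot V E p \<and>
        (let T = V - {p}; ET = {e \<in> E. p \<notin> e} in
          \<forall>l \<in> leaves T ET. \<forall>w \<in> nbhd T ET l. degree T ET w = 2))"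

definition interior :: "'b list \<Rightarrow> 'b set" where
  "interior xs = set (butlast (tl xs))"

definition subdivision_of :: "'b set \<Rightarrow> 'b set set \<Rightarrow> 'a set \<Rightarrow> 'a set set \<Rightarrow> bool" where
  "subdivision_of V' E' V E \<longleftrightarrow> graph V E \<and>
     (\<exists>(f :: 'a \<Rightarrow> 'b) (P :: 'a set \<Rightarrow> 'b list).
        inj_on f V \<and>
        (\<forall>e\<in>E. distinct (P e) \<and> length (P e) \<ge> 2 \<and>
                (\<exists>u v. e = {u, v} \<and> hd (P e) = f u \<and> last (P e) = f v) \<and>
                interior (P e) \<inter> f ` V = {}) \<and>
        (\<forall>e\<in>E. \<forall>e'\<in>E. e \<noteq> e' \<longrightarrow> interior (P e) \<inter> interior (P e') = {}) \<and>
        V' = f ` V \<union> (\<Union>e\<in>E. interior (P e)) \<and>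
        E' = (\<Union>e\<in>E. list_edges (P e)))"

text \<open>A box is given as (a, b, c, d), standing for [a,b] \<times> [c,d] with a < b, c < d.\<close>
type_synonym box = "real \<times> real \<times> real \<times> real"

definition valid_box :: "box \<Rightarrow> bool" where
  "valid_box B = (case B of (a, b, c, d) \<Rightarrow> a < b \<and> c < d)"

definition region :: "box \<Rightarrow> (real \<times> real) set" where
  "region B = (case B of (a, b, c, d) \<Rightarrow> {(x, y). a \<le> x \<and> x \<le> b \<and> c \<le> y \<and> y \<le> d})"

definition left_side :: "box \<Rightarrow> (real \<times> real) set" where
  "left_side B = (case B of (a, b, c, d) \<Rightarrow> {(x, y). x = a \<and> c \<le> y \<and> y \<le> d})"

definition right_side :: "box \<Rightarrow> (real \<times> real) set" where
  "right_side B = (case B of (a, b, c, d) \<Rightarrow> {(x, y). x = b \<and> c \<le> y \<and> y \<le> d})"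

definition bottom_side :: "box \<Rightarrow> (real \<times> real) set" where
  "bottom_side B = (case B of (a, b, c, d) \<Rightarrow> {(x, y). y = c \<and> a \<le> x \<and> x \<le> b})"

definition top_side :: "box \<Rightarrow> (real \<times> real) set" where
  "top_side B = (case B of (a, b, c, d) \<Rightarrow> {(x, y). y = d \<and> a \<le> x \<and> x \<le> b})"

definition frame :: "box \<Rightarrow> (real \<times> real) set" where
  "frame B = left_side B \<union> right_side B \<union> bottom_side B \<union> top_side B"

definition corners :: "box \<Rightarrow> (real \<times> real) set" where
  "corners B = (case B of (a, b, c, d) \<Rightarrow> {(a, c), (a, d), (b, c), (b, d)})"

definition restricted_frame_graph :: "'a set \<Rightarrow> 'a set set \<Rightarrow> bool" where
  "restricted_frame_graph V E \<longleftrightarrow> graph V E \<and>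
     (\<exists>F :: 'a \<Rightarrow> box.
        (\<forall>v\<in>V. valid_box (F v)) \<and>
        (\<forall>u\<in>V. \<forall>v\<in>V. u \<noteq> v \<longrightarrow> ({u, v} \<in> E \<longleftrightarrow> frame (F u) \<inter> frame (F v) \<noteq> {})) \<and>
        (\<forall>u\<in>V. \<forall>v\<in>V. u \<noteq> v \<longrightarrow> corners (F u) \<inter> frame (F v) = {}) \<and>
        (\<forall>u\<in>V. \<forall>v\<in>V. u \<noteq> v \<longrightarrow> left_side (F u) \<inter> frame (F v) = {}) \<and>
        (\<forall>u\<in>V. \<forall>v\<in>V. u \<noteq> v \<longrightarrow> right_side (F u) \<inter> frame (F v) \<noteq> {} \<longrightarrow>
            right_side (F u) \<inter> top_side (F v) \<noteq> {} \<and>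
            right_side (F u) \<inter> bottom_side (F v) \<noteq> {}) \<and>
        (\<forall>u\<in>V. \<forall>v\<in>V. u \<noteq> v \<longrightarrow> frame (F u) \<inter> frame (F v) \<noteq> {} \<longrightarrow>
            (\<forall>w\<in>V. \<not> frame (F w) \<subseteq> region (F u) \<inter> region (F v))))"

end

theory Submission
  imports Defs
begin

text \<open>
  Two meeting frames of a restricted frame representation always cross in the same way: one enters
  the other through its right side.  Orient the edges accordingly, from left to right.  If no frame
  surrounds another one, in-degrees are at most one and the graph is a forest.  In a graph without
  full star-cutsets a frame that surrounds something surrounds all its non-neighbours; hence, in the
  triangle-free case, deleting one vertex suffices to obtain a forest.  The absence of full
  star-cutsets in a graph of minimum degree two is inherited by subdivisions, and it forces the forest
  to be a tree whose leaves are the neighbours of the deleted vertex and are attached to vertices of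
  degree two.  Conversely, a rooted tree is drawn from left to right inside the frame of the pivot,
  through whose right side only the leaves are prolonged.
\<close>

section \<open>Reachability and cycles\<close>

text \<open>Absence of full star-cutsets does not pass to all subdivisions: a single edge has none,
  but the path on five vertices does (delete the star of its middle vertex). This forces the case
  distinction on minimum degree two. If some vertex has at most one neighbour, the star condition on
  the original graph alone leaves only the paths on at most four vertices, and no frames are
  involved. Otherwise the frames of the subdivision yield a vertex whose deletion destroys all
  cycles, but possibly an inner vertex of a path, so that it has to be moved back to a branch
  vertex.

  For the converse, paths and chandeliers share one description: an orientation in which only the
  pivot may have in-degree above one. The edges at the pivot are directed towards it, against their
  direction in the drawing, because this is stable under subdivision: when u -> p is replaced by a
  path, the inner vertices merely prolong a branch of the forest, and the last of them becomes a
  childless neighbour of the pivot in place of u.\<close>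

lemma adj_sym: "adj E u v \<Longrightarrow> adj E v u"
  by (auto simp: adj_def insert_commute)

lemma adj_in_verts:
  assumes "graph V E" "adj E u v"
  shows "u \<in> V \<and> v \<in> V \<and> u \<noteq> v"
proof -
  have "{u, v} \<in> E" "u \<noteq> v"
    using assms(2) by (auto simp: adj_def)
  then obtain x y where "x \<in> V" "y \<in> V" "{u, v} = {x, y}"
    using assms(1) unfolding graph_def by blast
  then show ?thesis
    using \<open>u \<noteq> v\<close> by (auto simp: doubleton_eq_iff)
qed

lemma edge_is_adj: "graph V E \<Longrightarrow> e \<in> E \<Longrightarrow> \<exists>u v. e = {u, v} \<and> adj E u v"
  unfolding graph_def adj_def by (metis (no_types, lifting))

lemma triangle_freeD:
  "graph V E \<Longrightarrow> triangle_free V E \<Longrightarrow> adj E x y \<Longrightarrow> adj E y z \<Longrightarrow> \<not> adj E x z"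
  using adj_in_verts[of V E x y] adj_in_verts[of V E y z] by (auto simp: triangle_free_def)

lemma reachable_refl [simp]: "reachable W E x x"
  by (simp add: reachable_def)

lemma reachable_trans: "reachable W E x y \<Longrightarrow> reachable W E y z \<Longrightarrow> reachable W E x z"
  by (simp add: reachable_def)

lemma reachable_edge: "x \<in> W \<Longrightarrow> y \<in> W \<Longrightarrow> adj E x y \<Longrightarrow> reachable W E x y"
  by (simp add: reachable_def r_into_rtranclp)

lemma reachable_sym: "reachable W E x y \<Longrightarrow> reachable W E y x"
  unfolding reachable_def
proof (induction rule: rtranclp_induct)
  case (step y z)
  then have "z \<in> W \<and> y \<in> W \<and> adj E z y"
    using adj_sym[of E y z] by simp
  with step.IH show ?case
    using converse_rtranclp_into_rtranclp[of "\<lambda>x y. x \<in> W \<and> y \<in> W \<and> adj E x y" z y x] by simp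
qed simp

lemma reachable_mono: "reachable W E x y \<Longrightarrow> W \<subseteq> W' \<Longrightarrow> reachable W' E x y"
  unfolding reachable_def by (erule rtranclp_induct) (auto intro: rtranclp.rtrancl_into_rtrancl)

lemma reachable_closed_set:
  assumes "reachable W E x y" "x \<in> C" "\<And>u v. u \<in> W \<Longrightarrow> v \<in> W \<Longrightarrow> adj E u v \<Longrightarrow> u \<in> C \<Longrightarrow> v \<in> C"
  shows "y \<in> C"
  using assms(1) unfolding reachable_def
  by (induction rule: rtranclp_induct) (use assms in auto)

text \<open>Each step of \<open>reachable\<close> already requires both ends in the vertex set, so
  the removal of the edges meeting S is invisible. From here on the edge set stays fixed and only
  vertex sets vary.\<close>

lemma reachable_delete_edges:
  "reachable (V - S) {e \<in> E. e \<inter> S = {}} x y \<longleftrightarrow> reachable (V - S) E x y"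
proof -
  have "(\<lambda>x y. x \<in> V - S \<and> y \<in> V - S \<and> adj {e \<in> E. e \<inter> S = {}} x y)
      = (\<lambda>x y. x \<in> V - S \<and> y \<in> V - S \<and> adj E x y)"
    by (auto simp: adj_def fun_eq_iff)
  then show ?thesis
    by (simp add: reachable_def)
qed

lemma not_full_star_cutsetD:
  assumes "\<not> has_full_star_cutset V E" "w \<in> V"
    "x \<in> V - closed_nbhd V E w" "y \<in> V - closed_nbhd V E w"
  shows "reachable (V - closed_nbhd V E w) E x y"
  using assms unfolding has_full_star_cutset_def disconnects_def reachable_delete_edges by blast

section \<open>Simple paths, cycles and distances in a tree\<close>

lemma reachable_imp_simple_path:
  assumes "reachable W E x y" "y \<in> W"
  shows "\<exists>xs. xs \<noteq> [] \<and> hd xs = x \<and> last xs = y \<and> distinct xs \<and> set xs \<subseteq> W \<and> successively (adj E) xs"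
  using assms(1) unfolding reachable_def
proof (induction rule: converse_rtranclp_induct)
  case base
  show ?case
    by (rule exI[of _ "[y]"]) (use assms in auto)
next
  case (step x z)
  then obtain zs where zs: "zs \<noteq> []" "hd zs = z" "last zs = y" "distinct zs" "set zs \<subseteq> W"
      "successively (adj E) zs"
    by blast
  show ?case
  proof (cases "x \<in> set zs")
    case True
    \<comment> \<open>The new first vertex already lies on the path: keep only the part that starts
      there.\<close>
    then obtain as bs where ab: "zs = as @ x # bs"
      by (meson split_list)
    show ?thesis
      by (rule exI[of _ "x # bs"]) (use zs ab in \<open>auto simp: successively_append_iff\<close>)
  next
    case False
    show ?thesis
      by (rule exI[of _ "x # zs"]) (use zs step False in \<open>auto simp: successively_Cons\<close>)
  qed
qed

text \<open>A simple path between two distinct neighbours of v that avoids v closes up through v,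
  and it has at least two vertices. All cycles below are produced in this way.\<close>

lemma has_cycle_through:
  assumes "v \<in> W" "u' \<in> W" "u \<noteq> u'" "adj E u v" "adj E u' v" "reachable (W - {v}) E u u'"
  shows "has_cycle W E"
proof -
  have "u' \<in> W - {v}"
    using assms by (auto simp: adj_def)
  from reachable_imp_simple_path[OF assms(6) this] obtain xs where xs: "xs \<noteq> []" "hd xs = u"
      "last xs = u'" "distinct xs" "set xs \<subseteq> W - {v}" "successively (adj E) xs"
    by blast
  have len: "length xs \<ge> 2"
    using xs(1-3) assms(3) by (cases xs; cases "tl xs") auto
  have "successively (adj E) (v # xs)"
    using xs assms adj_sym[OF assms(4)] by (auto simp: successively_Cons)
  then show ?thesis
    unfolding has_cycle_def using xs len assms
    by (intro exI[of _ "v # xs"]) (auto simp: successively_conv_nth)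
qed

text \<open>Converts a cycle into a nonempty edge set without vertices of degree one, the form in
  which acyclicity is later refuted for subdivisions. The index map \<open>s\<close> is the cyclic
  successor.\<close>

lemma cycle_two_edges_at_vertex:
  assumes "has_cycle W E"
  obtains F where "F \<noteq> {}" "\<And>e. e \<in> F \<Longrightarrow> e \<in> E \<and> e \<subseteq> W"
    "\<And>e v. e \<in> F \<Longrightarrow> v \<in> e \<Longrightarrow> \<exists>u u'. u \<noteq> u' \<and> {v, u} \<in> F \<and> {v, u'} \<in> F"
proof -
  from assms obtain xs where xs: "length xs \<ge> 3" "distinct xs" "set xs \<subseteq> W"
      "\<And>i. Suc i < length xs \<Longrightarrow> adj E (xs ! i) (xs ! Suc i)" "adj E (last xs) (hd xs)"
    unfolding has_cycle_def by blast
  define n where "n = length xs"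
  define s where "s i = (if Suc i = n then 0 else Suc i)" for i
  define F where "F = (\<lambda>i. {xs ! i, xs ! s i}) ` {..<n}"
  have n: "n \<ge> 3" "xs \<noteq> []"
    using xs(1) by (auto simp: n_def)
  have s: "s i < n" if "i < n" for i
    using that by (auto simp: s_def)
  \<comment> \<open>Length at least three enters here: predecessor and successor of an index on the
    cycle are different.\<close>
  have pre: "\<exists>j<n. s j = i \<and> j \<noteq> s i" if "i < n" for i
    by (rule exI[of _ "if i = 0 then n - 1 else i - 1"]) (use that n in \<open>auto simp: s_def\<close>)
  have two: "\<exists>u u'. u \<noteq> u' \<and> {xs ! i, u} \<in> F \<and> {xs ! i, u'} \<in> F" if i: "i < n" for i
  proof -
    obtain j where j: "j < n" "s j = i" "j \<noteq> s i"
      using pre i by blast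
    have "xs ! j \<noteq> xs ! s i"
      using xs(2) j s i by (simp add: nth_eq_iff_index_eq n_def)
    moreover have "{xs ! i, xs ! j} \<in> F" "{xs ! i, xs ! s i} \<in> F"
      using j i by (auto simp: F_def insert_commute)
    ultimately show ?thesis
      by blast
  qed
  show ?thesis
  proof
    show "F \<noteq> {}"
      using n by (auto simp: F_def lessThan_empty_iff)
    show "e \<in> E \<and> e \<subseteq> W" if "e \<in> F" for e
    proof -
      obtain i where i: "i < n" "e = {xs ! i, xs ! s i}"
        using \<open>e \<in> F\<close> by (auto simp: F_def)
      have "adj E (xs ! i) (xs ! s i)"
      proof (cases "Suc i = n")
        case True
        then have "i = length xs - 1"
          by (simp add: n_def)
        then show ?thesis
          using xs(5) n(2) by (simp add: s_def n_def last_conv_nth hd_conv_nth)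
      next
        case False
        then show ?thesis
          using xs(4) i by (simp add: s_def n_def)
      qed
      then show ?thesis
        using i s[OF i(1)] xs(3) by (auto simp: adj_def n_def)
    qed
    show "\<exists>u u'. u \<noteq> u' \<and> {v, u} \<in> F \<and> {v, u'} \<in> F" if ev: "e \<in> F" "v \<in> e" for e v
    proof -
      obtain i where "i < n" "v = xs ! i"
        using ev s by (auto simp: F_def)
      then show ?thesis
        using two by blast
    qed
  qed
qed

text \<open>\<open>rk\<close> is the distance from the root r. Both the absence of edges inside a
  level and the uniqueness of parents follow from \<open>unique\<close>: a vertex has only one
  neighbour that is not farther from the root.\<close>

lemma tree_bfs_rank:
  assumes conn: "connected_graph W E" and acyc: "\<not> has_cycle W E" and r: "r \<in> W"
  obtains rk :: "'a \<Rightarrow> nat" where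
    "\<And>u v. u \<in> W \<Longrightarrow> v \<in> W \<Longrightarrow> adj E u v \<Longrightarrow> rk v = Suc (rk u) \<or> rk u = Suc (rk v)"
    "\<And>v. v \<in> W \<Longrightarrow> v \<noteq> r \<Longrightarrow> \<exists>u\<in>W. adj E u v \<and> rk v = Suc (rk u)"
    "\<And>u u' v. u \<in> W \<Longrightarrow> u' \<in> W \<Longrightarrow> v \<in> W \<Longrightarrow> adj E u v \<Longrightarrow> adj E u' v \<Longrightarrow>
       rk v = Suc (rk u) \<Longrightarrow> rk v = Suc (rk u') \<Longrightarrow> u = u'"
proof -
  define R where "R = (\<lambda>x y. x \<in> W \<and> y \<in> W \<and> adj E x y)"
  define rk where "rk v = (LEAST n. (R ^^ n) r v)" for v
  have rk: "(R ^^ rk v) r v" if "v \<in> W" for v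
  proof -
    have "R\<^sup>*\<^sup>* r v"
      using conn r that unfolding connected_graph_def reachable_def R_def by blast
    then obtain n where "(R ^^ n) r v"
      by (meson rtranclp_imp_relpowp)
    then show ?thesis
      unfolding rk_def by (rule LeastI)
  qed
  have rk_le: "rk v \<le> n" if "(R ^^ n) r v" for n v
    using that unfolding rk_def by (rule Least_le)
  have step: "rk v \<le> Suc (rk u)" if "u \<in> W" "v \<in> W" "adj E u v" for u v
    using rk[OF that(1)] that by (intro rk_le) (auto simp: R_def)
  have parent: "\<exists>u\<in>W. adj E u v \<and> rk v = Suc (rk u)" if v: "v \<in> W" "v \<noteq> r" for v
  proof (cases "rk v")
    case 0
    then show ?thesis
      using rk[OF v(1)] v(2) by simp
  next
    case (Suc n)
    then have "(R ^^ Suc n) r v"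
      using rk[OF v(1)] by simp
    then obtain u where u: "(R ^^ n) r u" "R u v"
      by auto
    then have "rk u \<le> n" "u \<in> W" "adj E u v"
      using rk_le by (auto simp: R_def)
    with step[OF \<open>u \<in> W\<close> v(1)] Suc show ?thesis
      by auto
  qed
  \<comment> \<open>A shortest path from r to x visits only smaller ranks before x, hence misses
    every other vertex of rank at least \<open>rk x\<close>.\<close>
  have avoid: "reachable (W - {v}) E r x" if "x \<in> W" "v \<noteq> x" "rk x \<le> rk v" for x v
    using that
  proof (induction "rk x" arbitrary: x rule: less_induct)
    case less
    show ?case
    proof (cases "x = r")
      case False
      then obtain u where u: "u \<in> W" "adj E u x" "rk x = Suc (rk u)"
        using parent less.prems by blast
      then have "v \<noteq> u"
        using less.prems by auto
      then have "reachable (W - {v}) E r u"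
        using less u by simp
      moreover have "reachable (W - {v}) E u x"
        using u less.prems \<open>v \<noteq> u\<close> by (intro reachable_edge) auto
      ultimately show ?thesis
        by (rule reachable_trans)
    qed simp
  qed
  \<comment> \<open>Both neighbours reach the root without passing through v, so together with v
    they close a cycle.\<close>
  have unique: "u = u'" if "u \<in> W" "u' \<in> W" "v \<in> W" "adj E u v" "adj E u' v"
      "rk u \<le> rk v" "rk u' \<le> rk v" for u u' v
  proof (rule ccontr)
    assume "u \<noteq> u'"
    have "v \<noteq> u" "v \<noteq> u'"
      using that by (auto simp: adj_def)
    then have "reachable (W - {v}) E u u'"
      using that avoid by (meson reachable_sym reachable_trans)
    then show False
      using has_cycle_through \<open>u \<noteq> u'\<close> that acyc by metis
  qed
  show ?thesis
  proof
    show "rk v = Suc (rk u) \<or> rk u = Suc (rk v)" if uv: "u \<in> W" "v \<in> W" "adj E u v" for u v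
    proof -
      have "rk u \<noteq> rk v"
      proof
        assume eq: "rk u = rk v"
        have "u \<noteq> r \<or> v \<noteq> r"
          using uv by (auto simp: adj_def)
        then obtain x y where xy: "x \<in> W" "y \<in> W" "adj E x y" "rk x = rk y" "y \<noteq> r"
          using uv eq adj_sym[OF uv(3)] by metis
        then obtain z where "z \<in> W" "adj E z y" "rk y = Suc (rk z)"
          using parent by blast
        then show False
          using unique[of x z y] xy by auto
      qed
      then show ?thesis
        using step[of u v] step[of v u] uv adj_sym[of E u v] by linarith
    qed
  qed (use parent unique in auto)
qed

section \<open>Orientations towards a pivot\<close>

lemma list_edges_nth: "list_edges xs = {{xs ! i, xs ! Suc i} | i. Suc i < length xs}"
proof -
  have "list_edges xs = (\<lambda>i. {xs ! i, xs ! Suc i}) ` {i. Suc i < length xs}"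
    by (force simp: list_edges_def set_zip nth_tl image_iff)
  then show ?thesis
    by auto
qed

text \<open>Deleting \<open>p\<close> leaves a rooted forest oriented away from its roots; the neighbours of \<open>p\<close>
  are childless in that forest.\<close>

definition pivot_orientation ::
    "'a set \<Rightarrow> 'a set set \<Rightarrow> 'a \<Rightarrow> ('a \<Rightarrow> 'a \<Rightarrow> bool) \<Rightarrow> ('a \<Rightarrow> nat) \<Rightarrow> bool" where
  "pivot_orientation V E p D rk \<longleftrightarrow> p \<in> V \<and>
     (\<forall>u v. D u v \<longrightarrow> u \<in> V \<and> v \<in> V \<and> rk u < rk v) \<and>
     (\<forall>u\<in>V. \<forall>v\<in>V. adj E u v \<longleftrightarrow> D u v \<or> D v u) \<and>
     (\<forall>u u' v. D u v \<and> D u' v \<and> v \<noteq> p \<longrightarrow> u = u') \<and>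
     (\<forall>u v. D u p \<and> D u v \<longrightarrow> v = p) \<and>
     (\<forall>v. \<not> D p v)"

text \<open>Edges point along the list and its last vertex is the pivot; the positions in the list
  serve as ranks.\<close>

lemma path_graph_orientation:
  assumes "is_path_graph V E"
  shows "\<exists>p D rk. pivot_orientation V E p D rk"
proof -
  obtain xs where xs: "xs \<noteq> []" "distinct xs" "set xs = V" "E = list_edges xs"
    using assms unfolding is_path_graph_def by blast
  define D where "D u v \<longleftrightarrow> (\<exists>i. Suc i < length xs \<and> u = xs ! i \<and> v = xs ! Suc i)" for u v
  define rk where "rk u = (SOME i. i < length xs \<and> xs ! i = u)" for u
  have idx: "xs ! i = xs ! j \<longleftrightarrow> i = j" if "i < length xs" "j < length xs" for i j
    using that xs(2) by (simp add: nth_eq_iff_index_eq)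
  have rk: "rk (xs ! i) = i" if "i < length xs" for i
    unfolding rk_def using that idx by (intro some_equality) auto
  have last: "last xs = xs ! (length xs - 1)"
    using xs(1) by (simp add: last_conv_nth)
  have "pivot_orientation V E (last xs) D rk"
    unfolding pivot_orientation_def
  proof (intro conjI allI impI ballI)
    show "last xs \<in> V"
      using xs by auto
  next
    fix u v
    assume "D u v"
    then obtain i where "Suc i < length xs" "u = xs ! i" "v = xs ! Suc i"
      unfolding D_def by blast
    then show "u \<in> V" "v \<in> V" "rk u < rk v"
      using rk xs(3) by auto
  next
    fix u v
    have "{u, v} \<in> E \<longleftrightarrow> D u v \<or> D v u"
      unfolding D_def xs(4) list_edges_nth by (auto simp: doubleton_eq_iff)
    moreover have "u \<noteq> v" if "D u v \<or> D v u"
      using that idx unfolding D_def by fastforce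
    ultimately show "adj E u v \<longleftrightarrow> D u v \<or> D v u"
      unfolding adj_def by blast
  next
    fix u u' v
    assume "D u v \<and> D u' v \<and> v \<noteq> last xs"
    then show "u = u'"
      unfolding D_def using idx by fastforce
  next
    fix u v
    assume "D u (last xs) \<and> D u v"
    then show "v = last xs"
      unfolding D_def using idx by fastforce
  next
    fix v
    show "\<not> D (last xs) v"
      unfolding D_def last using idx by fastforce
  qed
  then show ?thesis
    by blast
qed

lemma adj_delete_vertex: "adj {e \<in> E. p \<notin> e} u v \<longleftrightarrow> adj E u v \<and> u \<noteq> p \<and> v \<noteq> p"
  by (auto simp: adj_def)

text \<open>The tree is directed away from a root, and each leaf points to p. The root must not be a
  leaf, for it would then have a child besides p. A suitable root exists: if every vertex of the
  tree were a leaf, two adjacent ones would form a triangle with p.\<close>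

lemma chandelier_orientation:
  assumes g: "graph V E" and tf: "triangle_free V E" and piv: "chandelier_pivot V E p"
  shows "\<exists>D rk. pivot_orientation V E p D rk"
proof -
  define T where "T = V - {p}"
  define ET where "ET = {e \<in> E. p \<notin> e}"
  have p: "p \<in> V" and tree: "connected_graph T ET" "\<not> has_cycle T ET"
      and nb: "nbhd V E p = leaves T ET"
    using piv unfolding chandelier_pivot_def is_tree_def T_def ET_def by auto
  have adjT: "adj ET u v \<longleftrightarrow> adj E u v \<and> u \<noteq> p \<and> v \<noteq> p" for u v
    unfolding ET_def by (rule adj_delete_vertex)
  have fin: "finite T"
    using g by (simp add: T_def graph_def)
  have leaf: "u = u'" if "v \<in> leaves T ET" "u \<in> T" "u' \<in> T" "adj ET v u" "adj ET v u'" for v u u'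
  proof -
    have "card (nbhd T ET v) = 1"
      using that by (simp add: leaves_def degree_def)
    then obtain z where "nbhd T ET v = {z}"
      by (auto simp: card_1_singleton_iff)
    moreover have "u \<in> nbhd T ET v" "u' \<in> nbhd T ET v"
      using that by (auto simp: nbhd_def)
    ultimately show ?thesis
      by auto
  qed
  have leaf_nb: "adj E p v \<longleftrightarrow> v \<in> leaves T ET" for v
    using nb adj_in_verts[OF g, of p v] by (auto simp: nbhd_def)
  have "\<exists>r\<in>T. r \<notin> leaves T ET"
  proof (rule ccontr)
    assume all: "\<not> (\<exists>r\<in>T. r \<notin> leaves T ET)"
    obtain t where t: "t \<in> T"
      using tree(1) by (auto simp: connected_graph_def)
    then have "card (nbhd T ET t) = 1"
      using all by (auto simp: leaves_def degree_def)
    then obtain z where "z \<in> nbhd T ET t"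
      by (auto simp: card_1_singleton_iff)
    then have z: "z \<in> T" "adj E t z"
      by (auto simp: nbhd_def adjT)
    then have "adj E p t" "adj E p z"
      using all t leaf_nb by auto
    then show False
      using triangle_freeD[OF g tf] z(2) by blast
  qed
  then obtain r where r: "r \<in> T" "r \<notin> leaves T ET"
    by blast
  obtain rk :: "'a \<Rightarrow> nat" where rk:
    "\<And>u v. u \<in> T \<Longrightarrow> v \<in> T \<Longrightarrow> adj ET u v \<Longrightarrow> rk v = Suc (rk u) \<or> rk u = Suc (rk v)"
    "\<And>v. v \<in> T \<Longrightarrow> v \<noteq> r \<Longrightarrow> \<exists>u\<in>T. adj ET u v \<and> rk v = Suc (rk u)"
    "\<And>u u' v. u \<in> T \<Longrightarrow> u' \<in> T \<Longrightarrow> v \<in> T \<Longrightarrow> adj ET u v \<Longrightarrow> adj ET u' v \<Longrightarrow>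
       rk v = Suc (rk u) \<Longrightarrow> rk v = Suc (rk u') \<Longrightarrow> u = u'"
    using tree_bfs_rank[OF tree r(1)] by blast
  define D where "D u v \<longleftrightarrow> adj E u v \<and> u \<in> T \<and> (v = p \<or> v \<in> T \<and> rk v = Suc (rk u))" for u v
  \<comment> \<open>The sum is merely a convenient upper bound for all ranks in the tree.\<close>
  define rk' where "rk' v = (if v = p then Suc (\<Sum>u\<in>T. rk u) else rk v)" for v
  have rk_le: "rk u \<le> (\<Sum>u\<in>T. rk u)" if "u \<in> T" for u
    using that fin by (intro member_le_sum) auto
  have T: "v \<in> T \<longleftrightarrow> v \<in> V \<and> v \<noteq> p" for v
    by (auto simp: T_def)
  have "pivot_orientation V E p D rk'"
    unfolding pivot_orientation_def
  proof (intro conjI allI impI ballI)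
    show "p \<in> V"
      by (rule p)
  next
    fix u v
    assume "D u v"
    then show "u \<in> V" "v \<in> V" "rk' u < rk' v"
      using rk_le[of u] p by (auto simp: D_def rk'_def T)
  next
    fix u v
    assume uv: "u \<in> V" "v \<in> V"
    show "adj E u v \<longleftrightarrow> D u v \<or> D v u"
    proof
      assume a: "adj E u v"
      then have "adj E v u" "u \<noteq> v"
        using adj_sym[OF a] by (auto simp: adj_def)
      then show "D u v \<or> D v u"
        using a uv rk(1)[of u v] by (auto simp: D_def T adjT)
    next
      assume "D u v \<or> D v u"
      then show "adj E u v"
        using adj_sym[of E v u] by (auto simp: D_def)
    qed
  next
    fix u u' v
    assume "D u v \<and> D u' v \<and> v \<noteq> p"
    then show "u = u'"
      using rk(3)[of u u' v] by (auto simp: D_def T adjT)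
  next
    fix u v
    assume a: "D u p \<and> D u v"
    show "v = p"
    proof (rule ccontr)
      assume "v \<noteq> p"
      then have v: "v \<in> T" "adj ET u v" "rk v = Suc (rk u)" "u \<in> T"
        using a by (auto simp: D_def adjT T)
      have "u \<in> leaves T ET"
        using a leaf_nb[of u] adj_sym[of E u p] by (auto simp: D_def)
      with r have "u \<noteq> r"
        by auto
      then obtain w where w: "w \<in> T" "adj ET w u" "rk u = Suc (rk w)"
        using rk(2) v(4) by blast
      then have "w = v"
        using leaf[OF \<open>u \<in> leaves T ET\<close> w(1) v(1) adj_sym[OF w(2)] v(2)] by simp
      then show False
        using w v by simp
    qed
  next
    fix v
    show "\<not> D p v"
      by (simp add: D_def T)
  qed
  then show ?thesis
    by blast
qed

section \<open>Frames from orientations\<close>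

text \<open>The only position that conditions (1)-(3) leave to two meeting frames: the right side of
  the first box cuts the second one from bottom to top, and the second box sticks out to the right.
  The relation is directed.\<close>

fun crosses :: "box \<Rightarrow> box \<Rightarrow> bool" where
  "crosses (a, b, c, d) (a', b', c', d') \<longleftrightarrow> a < a' \<and> a' < b \<and> b < b' \<and> c < c' \<and> d' < d"

fun inside :: "box \<Rightarrow> box \<Rightarrow> bool" where
  "inside (a', b', c', d') (a, b, c, d) \<longleftrightarrow> a < a' \<and> b' < b \<and> c < c' \<and> d' < d"

fun separated :: "box \<Rightarrow> box \<Rightarrow> bool" where
  "separated (a, b, c, d) (a', b', c', d') \<longleftrightarrow> b < a' \<or> b' < a \<or> d < c' \<or> d' < c"

text \<open>Non-strict, unlike \<open>inside\<close>, because condition (4) concerns closed regions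
  and also ranges over the two meeting frames themselves.\<close>

fun contained :: "box \<Rightarrow> box \<Rightarrow> bool" where
  "contained (a', b', c', d') (a, b, c, d) \<longleftrightarrow> a \<le> a' \<and> b' \<le> b \<and> c \<le> c' \<and> d' \<le> d"

lemmas side_defs = frame_def corners_def left_side_def right_side_def top_side_def bottom_side_def

lemma frame_eq:
  "frame (a, b, c, d) = {(x, y). (x = a \<or> x = b) \<and> c \<le> y \<and> y \<le> d \<or> (y = c \<or> y = d) \<and> a \<le> x \<and> x \<le> b}"
  by (auto simp: side_defs)

lemma frames_disjoint:
  assumes "valid_box B" "valid_box C" "separated B C \<or> inside B C \<or> inside C B"
  shows "frame B \<inter> frame C = {}"
  using assms by (cases B; cases C) (auto simp: valid_box_def frame_eq)

lemma crosses_frames: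
  assumes "valid_box B" "valid_box C" "crosses B C"
  shows "frame B \<inter> frame C \<noteq> {}"
    "corners B \<inter> frame C = {}" "corners C \<inter> frame B = {}"
    "left_side B \<inter> frame C = {}" "left_side C \<inter> frame B = {}"
    "right_side C \<inter> frame B = {}"
    "right_side B \<inter> top_side C \<noteq> {}" "right_side B \<inter> bottom_side C \<noteq> {}"
proof -
  obtain a b c d where B: "B = (a, b, c, d)"
    by (cases B)
  obtain a' b' c' d' where C: "C = (a', b', c', d')"
    by (cases C)
  have ineq: "a < b" "c < d" "a' < b'" "c' < d'" "a < a'" "a' < b" "b < b'" "c < c'" "d' < d"
    using assms by (auto simp: B C valid_box_def)
  have pt: "(b, d') \<in> right_side B" "(b, d') \<in> top_side C" "(b, c') \<in> right_side B" "(b, c') \<in> bottom_side C"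
    using ineq by (auto simp: B C side_defs)
  then show "right_side B \<inter> top_side C \<noteq> {}" "right_side B \<inter> bottom_side C \<noteq> {}"
    by blast+
  show "frame B \<inter> frame C \<noteq> {}"
    using pt unfolding frame_def by blast
  show "corners B \<inter> frame C = {}" "corners C \<inter> frame B = {}"
    "left_side B \<inter> frame C = {}" "left_side C \<inter> frame B = {}"
    "right_side C \<inter> frame B = {}"
    using ineq by (auto simp: B C frame_eq corners_def left_side_def right_side_def)
qed

lemma frame_subset_region:
  assumes "valid_box B" "frame B \<subseteq> region C"
  shows "contained B C"
proof -
  obtain a b c d where B: "B = (a, b, c, d)"
    by (cases B)
  obtain a' b' c' d' where C: "C = (a', b', c', d')"
    by (cases C)
  have "(a, c) \<in> frame B" "(b, d) \<in> frame B"
    using assms(1) by (auto simp: B side_defs valid_box_def)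
  then show ?thesis
    using assms(2) by (auto simp: B C region_def)
qed

lemma corners_subset_frame: "valid_box B \<Longrightarrow> corners B \<subseteq> frame B"
  by (cases B) (auto simp: valid_box_def side_defs)

lemma sides_subset_frame: "left_side B \<subseteq> frame B" "right_side B \<subseteq> frame B"
  by (auto simp: frame_def)

text \<open>Reduces a representation to inequalities between coordinates. Conditions (1)-(3) hold
  automatically once every pair of boxes crosses, is separated or is nested; only condition (4) has
  to be supplied.\<close>

lemma restricted_frame_graphI:
  assumes g: "graph V E" and valid: "\<And>v. v \<in> V \<Longrightarrow> valid_box (F v)"
    and cross: "\<And>u v. u \<in> V \<Longrightarrow> v \<in> V \<Longrightarrow> adj E u v \<Longrightarrow> crosses (F u) (F v) \<or> crosses (F v) (F u)"
    and apart: "\<And>u v. u \<in> V \<Longrightarrow> v \<in> V \<Longrightarrow> u \<noteq> v \<Longrightarrow> \<not> adj E u v \<Longrightarrow>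
      separated (F u) (F v) \<or> inside (F u) (F v) \<or> inside (F v) (F u)"
    and minimal: "\<And>u v w. u \<in> V \<Longrightarrow> v \<in> V \<Longrightarrow> w \<in> V \<Longrightarrow> crosses (F u) (F v) \<Longrightarrow>
      \<not> (contained (F w) (F u) \<and> contained (F w) (F v))"
  shows "restricted_frame_graph V E"
proof -
  have adj_iff: "{u, v} \<in> E \<longleftrightarrow> adj E u v" if "u \<noteq> v" for u v
    using that by (simp add: adj_def)
  have disj: "frame (F u) \<inter> frame (F v) = {}" if "u \<in> V" "v \<in> V" "u \<noteq> v" "\<not> adj E u v" for u v
    using frames_disjoint[OF valid valid apart] that by blast
  have meet: "frame (F u) \<inter> frame (F v) \<noteq> {}" if "u \<in> V" "v \<in> V" "adj E u v" for u v
    using cross[OF that] crosses_frames(1)[OF valid valid] that by (metis inf_commute)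
  have cond: "corners (F u) \<inter> frame (F v) = {} \<and> left_side (F u) \<inter> frame (F v) = {} \<and>
      (right_side (F u) \<inter> frame (F v) \<noteq> {} \<longrightarrow>
        right_side (F u) \<inter> top_side (F v) \<noteq> {} \<and> right_side (F u) \<inter> bottom_side (F v) \<noteq> {})"
    if uv: "u \<in> V" "v \<in> V" "u \<noteq> v" for u v
  proof (cases "adj E u v")
    case True
    from cross[OF uv(1,2) True] show ?thesis
    proof
      assume "crosses (F u) (F v)"
      then show ?thesis
        using crosses_frames[OF valid[OF uv(1)] valid[OF uv(2)]] by auto
    next
      assume "crosses (F v) (F u)"
      then show ?thesis
        using crosses_frames[OF valid[OF uv(2)] valid[OF uv(1)]] by auto
    qed
  next
    case False
    then show ?thesis
      using disj[OF uv False] corners_subset_frame[OF valid[OF uv(1)]] sides_subset_frame[of "F u"]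
      by blast
  qed
  have inner: "\<not> frame (F w) \<subseteq> region (F u) \<inter> region (F v)"
    if "u \<in> V" "v \<in> V" "u \<noteq> v" "frame (F u) \<inter> frame (F v) \<noteq> {}" "w \<in> V" for u v w
  proof
    assume "frame (F w) \<subseteq> region (F u) \<inter> region (F v)"
    then have "contained (F w) (F u)" "contained (F w) (F v)"
      using frame_subset_region valid that(5) by blast+
    moreover have "adj E u v"
      using disj that by blast
    ultimately show False
      using cross[of u v] minimal[of u v w] minimal[of v u w] that by blast
  qed
  show ?thesis
    unfolding restricted_frame_graph_def
    using g valid adj_iff disj meet cond inner by (intro conjI exI[of _ F]) (simp | blast)+
qed

text \<open>Every vertex owns a fixed subinterval of (0, 1), and these are pairwise disjoint. The
  slot of a child is its own subinterval carried affinely into the slot of its parent. Two vertices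
  of equal depth are then separate because they are roots, or siblings, or because their parents
  already are.\<close>

lemma forest_depth_and_slots:
  fixes rk :: "'a \<Rightarrow> nat"
  assumes D: "\<And>u v. D u v \<Longrightarrow> u \<in> V \<and> v \<in> V \<and> rk u < rk v"
    and unique: "\<And>u u' v. D u v \<Longrightarrow> D u' v \<Longrightarrow> u = u'" and fin: "finite V"
  obtains dep :: "'a \<Rightarrow> nat" and lo hi :: "'a \<Rightarrow> real" where
    "\<And>v. v \<in> V \<Longrightarrow> 0 < lo v \<and> lo v < hi v \<and> hi v < 1"
    "\<And>u v. D u v \<Longrightarrow> dep v = Suc (dep u) \<and> lo u < lo v \<and> hi v < hi u"
    "\<And>u v. u \<in> V \<Longrightarrow> v \<in> V \<Longrightarrow> u \<noteq> v \<Longrightarrow> dep u = dep v \<Longrightarrow> hi u < lo v \<or> hi v < lo u"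
    "\<And>v. v \<in> V \<Longrightarrow> dep v \<noteq> 0 \<Longrightarrow> \<exists>u. D u v"
proof -
  obtain idx where idx: "bij_betw idx V {0..<card V}"
    using ex_bij_betw_finite_nat[OF fin] by blast
  \<comment> \<open>Each vertex receives three units, of which only the middle one is used. This
    keeps the intervals strictly apart and away from 0 and 1.\<close>
  define N where "N = real (3 * card V)"
  define \<alpha> where "\<alpha> v = real (3 * idx v + 1) / N" for v
  define \<beta> where "\<beta> v = real (3 * idx v + 2) / N" for v
  have idx_lt: "idx v < card V" if "v \<in> V" for v
    using idx that by (auto simp: bij_betw_def)
  have ab: "0 < \<alpha> v \<and> \<alpha> v < \<beta> v \<and> \<beta> v < 1" if "v \<in> V" for v
  proof -
    have "N > real (3 * idx v + 2)"
      using idx_lt[OF that] unfolding N_def by linarith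
    then show ?thesis
      by (simp add: \<alpha>_def \<beta>_def divide_simps)
  qed
  have ab_disj: "\<beta> u < \<alpha> v \<or> \<beta> v < \<alpha> u" if uv: "u \<in> V" "v \<in> V" "u \<noteq> v" for u v
  proof -
    have "idx u \<noteq> idx v"
      using idx uv by (auto simp: bij_betw_def inj_on_def)
    moreover have "N > 0"
      using idx_lt[OF uv(1)] unfolding N_def by linarith
    moreover have "3 * idx u + 2 < 3 * idx v + 1 \<or> 3 * idx v + 2 < 3 * idx u + 1"
      using \<open>idx u \<noteq> idx v\<close> by linarith
    ultimately show ?thesis
      unfolding \<alpha>_def \<beta>_def by (metis divide_strict_right_mono of_nat_less_iff)
  qed
  define par where "par v = (THE u. D u v)" for v
  have par: "par v = u" if "D u v" for u v
    unfolding par_def using that unique by (intro the_equality) auto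
  define G :: "('a \<Rightarrow> nat \<times> real \<times> real) \<Rightarrow> 'a \<Rightarrow> nat \<times> real \<times> real" where
    "G f v = (if \<exists>u. D u v then (case f (par v) of (k, l, h) \<Rightarrow>
        (Suc k, l + (h - l) * \<alpha> v, l + (h - l) * \<beta> v)) else (0, \<alpha> v, \<beta> v))" for f v
  \<comment> \<open>The triple of depth, lower end and upper end is computed by well-founded
    recursion from that of the parent, whose \<open>rk\<close> is smaller.\<close>
  define g where "g = wfrec (measure rk) G"
  have g: "g v = G g v" for v
  proof -
    have "g v = G (cut g (measure rk) v) v"
      unfolding g_def by (rule wfrec) simp
    also have "\<dots> = G g v"
      using D par by (auto simp: G_def cut_def)
    finally show ?thesis .
  qed
  define dep where "dep v = fst (g v)" for v
  define lo where "lo v = fst (snd (g v))" for v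
  define hi where "hi v = snd (snd (g v))" for v
  note defs = dep_def lo_def hi_def
  have root: "dep v = 0 \<and> lo v = \<alpha> v \<and> hi v = \<beta> v" if "\<not> (\<exists>u. D u v)" for v
    using that by (simp add: defs g[of v] G_def)
  have child: "dep v = Suc (dep u) \<and> lo v = lo u + (hi u - lo u) * \<alpha> v \<and> hi v = lo u + (hi u - lo u) * \<beta> v"
    if "D u v" for u v
  proof -
    have "\<exists>u. D u v"
      using that by blast
    then show ?thesis
      using par[OF that] by (simp add: defs g[of v] G_def split: prod.splits)
  qed
  have nested: "lo u < lo v \<and> lo v < hi v \<and> hi v < hi u" if "D u v" "lo u < hi u" for u v
  proof -
    define t where "t = hi u - lo u"
    have t: "t > 0" "hi u = lo u + t"
      using that by (auto simp: t_def)
    have v: "0 < \<alpha> v" "\<alpha> v < \<beta> v" "\<beta> v < 1"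
      using ab D[OF that(1)] by auto
    have "0 < t * \<alpha> v" "t * \<alpha> v < t * \<beta> v" "t * \<beta> v < t * 1"
      using t v by (auto intro!: mult_strict_left_mono)
    moreover have "lo v = lo u + t * \<alpha> v" "hi v = lo u + t * \<beta> v"
      using child[OF that(1)] by (auto simp: t_def)
    ultimately show ?thesis
      using t(2) by linarith
  qed
  have range: "0 < lo v \<and> lo v < hi v \<and> hi v < 1" if "v \<in> V" for v
    using that
  proof (induction "rk v" arbitrary: v rule: less_induct)
    case less
    show ?case
    proof (cases "\<exists>u. D u v")
      case True
      then obtain u where u: "D u v"
        by blast
      then have "0 < lo u \<and> lo u < hi u \<and> hi u < 1"
        using less.hyps D by blast
      then show ?thesis
        using nested[OF u] by linarith
    next
      case False
      then show ?thesis
        using root ab less.prems by auto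
    qed
  qed
  have nonroot: "\<exists>u. D u v" if "dep v \<noteq> 0" for v
    using root[of v] that by auto
  have disj: "hi u < lo v \<or> hi v < lo u" if "u \<in> V" "v \<in> V" "u \<noteq> v" "dep u = dep v" for u v
    using that
  proof (induction "dep v" arbitrary: u v)
    case 0
    then have "\<not> (\<exists>w. D w u)" "\<not> (\<exists>w. D w v)"
      using child by force+
    then show ?case
      using root ab_disj[OF 0(2,3,4)] by simp
  next
    case (Suc n)
    then obtain x y where xy: "D x u" "D y v"
      using nonroot[of u] nonroot[of v] by auto
    have xyV: "x \<in> V" "y \<in> V"
      using D xy by auto
    show ?case
    proof (cases "x = y")
      case True
      define t where "t = hi x - lo x"
      have t: "t > 0"
        using range xyV by (auto simp: t_def)
      have "\<beta> u < \<alpha> v \<or> \<beta> v < \<alpha> u"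
        using ab_disj Suc by blast
      then have "t * \<beta> u < t * \<alpha> v \<or> t * \<beta> v < t * \<alpha> u"
        using t by simp
      then show ?thesis
        using child[OF xy(1)] child[OF xy(2)] True by (auto simp: t_def)
    next
      case False
      have "dep y = n" "dep x = n"
        using child[OF xy(1)] child[OF xy(2)] Suc by auto
      then have "hi x < lo y \<or> hi y < lo x"
        using Suc(1)[of y x] xyV False by auto
      moreover have "lo x < lo u" "hi u < hi x" "lo y < lo v" "hi v < hi y"
        using nested[OF xy(1)] nested[OF xy(2)] range xyV by auto
      ultimately show ?thesis
        by linarith
    qed
  qed
  show ?thesis
  proof (rule that[of lo hi dep])
    show "dep v = Suc (dep u) \<and> lo u < lo v \<and> hi v < hi u" if "D u v" for u v
      using child[OF that] nested[OF that] range D[OF that] by auto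
  qed (use range disj nonroot in auto)
qed

text \<open>The depth gives the abscissa and the nested slots the ordinates; the frame of the pivot
  surrounds everything, and only its neighbours, being childless, are prolonged through its
  right side.\<close>

lemma pivot_orientation_imp_restricted_frame_graph:
  assumes g: "graph V E" and po: "pivot_orientation V E p D rk"
  shows "restricted_frame_graph V E"
proof -
  define D0 where "D0 u v \<longleftrightarrow> D u v \<and> v \<noteq> p" for u v
  have p: "p \<in> V" and DV: "\<And>u v. D u v \<Longrightarrow> u \<in> V \<and> v \<in> V \<and> rk u < rk v"
    and Dadj: "\<And>u v. u \<in> V \<Longrightarrow> v \<in> V \<Longrightarrow> adj E u v \<longleftrightarrow> D u v \<or> D v u"
    and Duniq: "\<And>u u' v. D u v \<Longrightarrow> D u' v \<Longrightarrow> v \<noteq> p \<Longrightarrow> u = u'"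
    and Dp: "\<And>u v. D u p \<Longrightarrow> D u v \<Longrightarrow> v = p" and Dp': "\<And>v. \<not> D p v"
    using po unfolding pivot_orientation_def by blast+
  let ?V = "V - {p}"
  have "finite V"
    using g by (simp add: graph_def)
  then have fin: "finite ?V"
    by simp
  have D0: "u \<in> ?V \<and> v \<in> ?V \<and> rk u < rk v" if "D0 u v" for u v
    using that DV[of u v] Dp' by (auto simp: D0_def)
  have D0u: "u = u'" if "D0 u v" "D0 u' v" for u u' v
    using that Duniq by (auto simp: D0_def)
  obtain dep :: "'a \<Rightarrow> nat" and lo hi :: "'a \<Rightarrow> real" where
    rng: "\<And>v. v \<in> ?V \<Longrightarrow> 0 < lo v \<and> lo v < hi v \<and> hi v < 1" and
    chld: "\<And>u v. D0 u v \<Longrightarrow> dep v = Suc (dep u) \<and> lo u < lo v \<and> hi v < hi u" and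
    level: "\<And>u v. u \<in> ?V \<Longrightarrow> v \<in> ?V \<Longrightarrow> u \<noteq> v \<Longrightarrow> dep u = dep v \<Longrightarrow> hi u < lo v \<or> hi v < lo u" and
    nonroot: "\<And>v. v \<in> ?V \<Longrightarrow> dep v \<noteq> 0 \<Longrightarrow> \<exists>u. D0 u v"
    by (rule forest_depth_and_slots[of D0 ?V rk]) (assumption | rule D0 D0u fin that)+
  \<comment> \<open>Large enough to lie to the right of every frame that is not prolonged.\<close>
  define M where "M = real (\<Sum>v\<in>?V. dep v) + 2"
  have M: "real (dep v) + 3/2 < M" if "v \<in> ?V" for v
  proof -
    have "dep v \<le> (\<Sum>v\<in>?V. dep v)"
      using that fin by (intro member_le_sum) auto
    then show ?thesis
      unfolding M_def by linarith
  qed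
  \<comment> \<open>Left sides stand at the depths. The overhang 3/2 lets a frame enter its
    children, at distance 1, stop before vertices two levels deeper, and end before the right sides
    of its children. Neighbours of the pivot extend beyond M instead.\<close>
  define re where "re v = (if D v p then M + 1 else real (dep v) + 3/2)" for v
  define F :: "'a \<Rightarrow> box" where
    "F v = (if v = p then (-1, M, -1, 2) else (real (dep v), re v, lo v, hi v))" for v
  have Fp: "F p = (-1, M, -1, 2)"
    by (simp add: F_def)
  have F: "F v = (real (dep v), re v, lo v, hi v)" if "v \<in> ?V" for v
    using that by (simp add: F_def)
  have re_ge: "real (dep v) + 3/2 \<le> re v" if "v \<in> ?V" for v
    using M[OF that] by (simp add: re_def)
  \<comment> \<open>A prolonged frame spans all greater depths, so its slot must avoid every slot
    there. It does: a vertex whose slot overlaps would descend from v, and v has no child in the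
    forest. The induction climbs from u to its parent.\<close>
  have childless: "hi u < lo v \<or> hi v < lo u"
    if "D v p" "u \<in> ?V" "v \<in> ?V" "u \<noteq> v" "dep v \<le> dep u" for u v
    using that
  proof (induction "dep u - dep v" arbitrary: u)
    case 0
    then show ?case
      using level[of u v] by auto
  next
    case (Suc n)
    then have "dep u \<noteq> 0"
      by linarith
    then obtain w where w: "D0 w u"
      using nonroot[of u] Suc.prems by blast
    have "w \<noteq> v"
      using w Suc.prems(1) Dp by (auto simp: D0_def)
    then have "hi w < lo v \<or> hi v < lo w"
      using Suc chld[OF w] D0[OF w] by auto
    then show ?case
      using chld[OF w] by auto
  qed
  have forest: "D0 u v \<and> crosses (F u) (F v) \<or> \<not> D0 u v \<and> separated (F u) (F v)"
    if uv: "u \<in> ?V" "v \<in> ?V" "u \<noteq> v" "dep u \<le> dep v" for u v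
  proof (cases "D0 u v")
    case True
    then have "re u = real (dep u) + 3/2"
      using Dp by (auto simp: re_def D0_def)
    then have "crosses (F u) (F v)"
      using F uv chld[OF True] re_ge[of v] by auto
    then show ?thesis
      using True by blast
  next
    case False
    have "hi u < lo v \<or> hi v < lo u \<or> re u < real (dep v)"
    proof (cases "D u p")
      case True
      then show ?thesis
        using childless[OF True uv(2,1)] uv by auto
    next
      case ndp: False
      consider "dep u = dep v" | "dep v = Suc (dep u)" | "dep v \<ge> dep u + 2"
        using uv(4) by linarith
      then show ?thesis
      proof cases
        case 1
        then show ?thesis
          using level uv by auto
      next
        case 2
        then obtain w where w: "D0 w v"
          using nonroot[of v] uv by auto
        then have "w \<noteq> u" "dep w = dep u" "w \<in> ?V"
          using False 2 chld[OF w] D0[OF w] by auto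
        then show ?thesis
          using level[of u w] uv chld[OF w] by auto
      next
        case 3
        then have "real (dep u) + 2 \<le> real (dep v)"
          by linarith
        then show ?thesis
          using ndp by (simp add: re_def)
      qed
    qed
    then show ?thesis
      using False F uv by auto
  qed
  have D0_dep: "dep u < dep v" if "D0 u v" for u v
    using chld[OF that] by simp
  have pair: "D0 u v \<and> crosses (F u) (F v) \<or> D0 v u \<and> crosses (F v) (F u) \<or>
      \<not> D0 u v \<and> \<not> D0 v u \<and> (separated (F u) (F v) \<or> separated (F v) (F u))"
    if uv: "u \<in> ?V" "v \<in> ?V" "u \<noteq> v" for u v
  proof (cases "dep u \<le> dep v")
    case True
    then show ?thesis
      using forest[OF uv] D0_dep[of v u] by auto
  next
    case False
    then show ?thesis
      using forest[of v u] D0_dep[of u v] uv by auto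
  qed
  have sep_sym: "separated B C \<longleftrightarrow> separated C B" for B C
    by (cases B; cases C) auto
  \<comment> \<open>Edges at the pivot are drawn against their orientation: the right side of the
    surrounding frame cuts the prolonged ones.\<close>
  have pcross: "crosses (F p) (F v)" if "v \<in> ?V" "D v p" for v
    using that F M[of v] rng[of v] by (auto simp: Fp re_def)
  have pin: "inside (F v) (F p)" if "v \<in> ?V" "\<not> D v p" for v
    using that F M[of v] rng[of v] by (auto simp: Fp re_def)
  have valid: "valid_box (F v)" if "v \<in> V" for v
  proof (cases "v = p")
    case True
    have "M > 0"
      unfolding M_def by (rule add_nonneg_pos) (auto intro: sum_nonneg)
    then show ?thesis
      by (simp add: True Fp valid_box_def)
  next
    case False
    then show ?thesis
      using that F rng[of v] re_ge[of v] by (auto simp: valid_box_def)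
  qed
  have no_cont: "\<not> contained (F w) (F v)" if "v \<in> ?V" "w \<in> V" "w \<noteq> v" for v w
  proof (cases "w = p")
    case True
    then show ?thesis
      using F that by (auto simp: Fp)
  next
    case False
    have sep: "\<not> contained B C" if "separated B C \<or> separated C B" "valid_box B" for B C
      using that by (cases B; cases C) (auto simp: valid_box_def)
    have cro: "\<not> contained B C" if "crosses B C \<or> crosses C B" for B C
      using that by (cases B; cases C) auto
    show ?thesis
      using pair[of w v] that False sep[OF _ valid] cro by blast
  qed
  show ?thesis
  proof (rule restricted_frame_graphI[OF g valid])
    fix u v
    assume uv: "u \<in> V" "v \<in> V" "adj E u v"
    then have d: "D u v \<or> D v u" "u \<noteq> v"
      using Dadj by (auto simp: adj_def)
    consider "u = p" | "v = p" | "u \<in> ?V" "v \<in> ?V"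
      using uv by blast
    then show "crosses (F u) (F v) \<or> crosses (F v) (F u)"
    proof cases
      case 1
      then show ?thesis
        using d pcross[of v] uv Dp' by auto
    next
      case 2
      then show ?thesis
        using d pcross[of u] uv Dp' by auto
    next
      case 3
      then have "D0 u v \<or> D0 v u"
        using d by (auto simp: D0_def)
      then show ?thesis
        using pair[OF 3 d(2)] by blast
    qed
  next
    fix u v
    assume uv: "u \<in> V" "v \<in> V" "u \<noteq> v" "\<not> adj E u v"
    then have d: "\<not> D u v" "\<not> D v u"
      using Dadj by auto
    consider "u = p" | "v = p" | "u \<in> ?V" "v \<in> ?V"
      using uv by blast
    then show "separated (F u) (F v) \<or> inside (F u) (F v) \<or> inside (F v) (F u)"
    proof cases
      case 1
      then show ?thesis
        using d pin[of v] uv by auto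
    next
      case 2
      then show ?thesis
        using d pin[of u] uv by auto
    next
      case 3
      then show ?thesis
        using pair[OF 3 uv(3)] d sep_sym[of "F u" "F v"] by (auto simp: D0_def)
    qed
  next
    fix u v w
    assume uvw: "u \<in> V" "v \<in> V" "w \<in> V" "crosses (F u) (F v)"
    have irr: "\<not> contained B C" if "crosses C B" for B C
      using that by (cases B; cases C) auto
    \<comment> \<open>The crossed vertex v is never the pivot, whose left side is leftmost. Hence F
      v contains no frame but itself, and it sticks out of F u.\<close>
    show "\<not> (contained (F w) (F u) \<and> contained (F w) (F v))"
    proof (cases "v = p")
      case True
      then have "u \<in> ?V"
        using uvw by (cases "F v") auto
      then show ?thesis
        using uvw True F by (auto simp: Fp)
    next
      case False
      then show ?thesis
        using no_cont[of v w] uvw irr by (cases "w = v") auto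
    qed
  qed
qed

section \<open>Subdivisions\<close>

text \<open>\<open>Q u v\<close> is the path replacing the edge \<open>uv\<close>, traversed from \<open>f u\<close> to \<open>f v\<close>.\<close>

locale subdivision =
  fixes V :: "'a set" and E :: "'a set set" and V' :: "'b set" and E' :: "'b set set"
    and f :: "'a \<Rightarrow> 'b" and Q :: "'a \<Rightarrow> 'a \<Rightarrow> 'b list"
  assumes g: "graph V E" and inj: "inj_on f V"
    and Q_distinct: "adj E u v \<Longrightarrow> distinct (Q u v)"
    and Q_length: "adj E u v \<Longrightarrow> 2 \<le> length (Q u v)"
    and Q_first: "adj E u v \<Longrightarrow> Q u v ! 0 = f u"
    and Q_rev: "adj E u v \<Longrightarrow> Q v u = rev (Q u v)"
    and Q_inner: "adj E u v \<Longrightarrow> 0 < i \<Longrightarrow> Suc i < length (Q u v) \<Longrightarrow> Q u v ! i \<notin> f ` V"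
    and Q_disjoint: "adj E u v \<Longrightarrow> adj E x y \<Longrightarrow> {u, v} \<noteq> {x, y} \<Longrightarrow> 0 < i \<Longrightarrow> Suc i < length (Q u v) \<Longrightarrow>
      0 < j \<Longrightarrow> Suc j < length (Q x y) \<Longrightarrow> Q u v ! i \<noteq> Q x y ! j"
    and V'_eq: "V' = f ` V \<union> {Q u v ! i | u v i. adj E u v \<and> 0 < i \<and> Suc i < length (Q u v)}"
    and E'_eq: "E' = {{Q u v ! i, Q u v ! Suc i} | u v i. adj E u v \<and> Suc i < length (Q u v)}"

lemma interior_nth: "interior xs = {xs ! i | i. 0 < i \<and> Suc i < length xs}"
proof -
  have "interior xs = {butlast (tl xs) ! i | i. i < length (butlast (tl xs))}"
    unfolding interior_def by (rule set_conv_nth)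
  also have "\<dots> = {xs ! Suc i | i. Suc (Suc i) < length xs}"
    by (intro Collect_cong ex_cong1) (auto simp: nth_butlast nth_tl less_diff_conv)
  also have "\<dots> = {xs ! i | i. 0 < i \<and> Suc i < length xs}"
    by (rule Collect_cong) (metis Suc_pred zero_less_Suc)
  finally show ?thesis .
qed

lemma interior_rev: "interior (rev xs) = interior xs"
  by (cases xs; cases "tl xs" rule: rev_cases) (auto simp: interior_def butlast_append)

lemma list_edges_rev: "list_edges (rev xs) = list_edges xs"
proof -
  have sub: "list_edges (rev ys) \<subseteq> list_edges ys" for ys :: "'a list"
  proof
    fix e
    assume "e \<in> list_edges (rev ys)"
    then obtain i where i: "Suc i < length ys" "e = {rev ys ! i, rev ys ! Suc i}"
      by (auto simp: list_edges_nth)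
    define j where "j = length ys - Suc (Suc i)"
    have "Suc j < length ys" "length ys - Suc i = Suc j"
      using i by (auto simp: j_def)
    then have "e = {ys ! j, ys ! Suc j}"
      using i by (auto simp: rev_nth j_def)
    then show "e \<in> list_edges ys"
      using \<open>Suc j < length ys\<close> by (auto simp: list_edges_nth)
  qed
  show ?thesis
    using sub[of xs] sub[of "rev xs"] by simp
qed

text \<open>The definition supplies one list per edge, in an unspecified direction. Choosing a list
  for each ordered pair makes both directions interchangeable; the test on the head is decisive
  since f u and f v differ.\<close>

lemma subdivision_ofE:
  assumes "subdivision_of V' E' V E"
  obtains f Q where "subdivision V E V' E' f Q"
proof -
  obtain f P where g: "graph V E" and inj: "inj_on f V"
    and P: "\<forall>e\<in>E. distinct (P e) \<and> length (P e) \<ge> 2 \<and>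
        (\<exists>u v. e = {u, v} \<and> hd (P e) = f u \<and> last (P e) = f v) \<and> interior (P e) \<inter> f ` V = {}"
    and disj: "\<forall>e\<in>E. \<forall>e'\<in>E. e \<noteq> e' \<longrightarrow> interior (P e) \<inter> interior (P e') = {}"
    and V': "V' = f ` V \<union> (\<Union>e\<in>E. interior (P e))" and E': "E' = (\<Union>e\<in>E. list_edges (P e))"
    using assms unfolding subdivision_of_def by (elim conjE exE) rule
  define Q where "Q u v = (if hd (P {u, v}) = f u then P {u, v} else rev (P {u, v}))" for u v
  have ends: "u \<in> V" "v \<in> V" "f u \<noteq> f v" "{u, v} \<in> E" "P {u, v} \<noteq> []" "distinct (P {u, v})" "length (P {u, v}) \<ge> 2"
    "hd (P {u, v}) = f u \<and> last (P {u, v}) = f v \<or> hd (P {u, v}) = f v \<and> last (P {u, v}) = f u"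
    if a: "adj E u v" for u v
  proof -
    show uv: "u \<in> V" "v \<in> V"
      using adj_in_verts[OF g a] by auto
    show "f u \<noteq> f v"
      using inj uv adj_in_verts[OF g a] by (auto simp: inj_on_def)
    show e: "{u, v} \<in> E"
      using a by (simp add: adj_def)
    show "P {u, v} \<noteq> []" "distinct (P {u, v})" "length (P {u, v}) \<ge> 2"
      using bspec[OF P e] by auto
    show "hd (P {u, v}) = f u \<and> last (P {u, v}) = f v \<or> hd (P {u, v}) = f v \<and> last (P {u, v}) = f u"
      using bspec[OF P e] by (auto simp: doubleton_eq_iff)
  qed
  have intQ: "interior (Q u v) = interior (P {u, v})" for u v
    by (simp add: Q_def interior_rev)
  have edgQ: "list_edges (Q u v) = list_edges (P {u, v})" for u v
    by (simp add: Q_def list_edges_rev)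
  have un: "x \<in> (\<Union>e\<in>E. h e) \<longleftrightarrow> (\<exists>u v. adj E u v \<and> x \<in> h {u, v})" for x :: 'c and h
  proof
    assume "x \<in> (\<Union>e\<in>E. h e)"
    then obtain e where "e \<in> E" "x \<in> h e"
      by blast
    then show "\<exists>u v. adj E u v \<and> x \<in> h {u, v}"
      using edge_is_adj[OF g, of e] by auto
  next
    assume "\<exists>u v. adj E u v \<and> x \<in> h {u, v}"
    then obtain u v where "{u, v} \<in> E" "x \<in> h {u, v}"
      by (auto simp: adj_def)
    then show "x \<in> (\<Union>e\<in>E. h e)"
      by blast
  qed
  have un_int: "x \<in> (\<Union>e\<in>E. interior (P e)) \<longleftrightarrow> (\<exists>u v. adj E u v \<and> x \<in> interior (Q u v))" for x
    by (simp only: un intQ)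
  have un_edg: "x \<in> (\<Union>e\<in>E. list_edges (P e)) \<longleftrightarrow> (\<exists>u v. adj E u v \<and> x \<in> list_edges (Q u v))" for x
    by (simp only: un edgQ)
  have inn: "Q u v ! i \<in> interior (P {u, v})" if "0 < i" "Suc i < length (Q u v)" for u v i
    using that intQ[of u v] interior_nth[of "Q u v"] by blast
  have "subdivision V E V' E' f Q"
  proof
    show "graph V E" "inj_on f V"
      by fact+
    fix u v
    assume a: "adj E u v"
    note uv = ends[OF a]
    show "distinct (Q u v)" "2 \<le> length (Q u v)"
      using uv by (auto simp: Q_def)
    show "Q u v ! 0 = f u"
      using uv(5,8) by (auto simp: Q_def hd_conv_nth[symmetric] hd_rev)
    show "Q v u = rev (Q u v)"
      using uv(3,8) by (auto simp: Q_def insert_commute)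
    show "Q u v ! i \<notin> f ` V" if "0 < i" "Suc i < length (Q u v)" for i
      using inn[OF that] bspec[OF P uv(4)] by blast
    show "Q u v ! i \<noteq> Q x y ! j" if "adj E x y" "{u, v} \<noteq> {x, y}" "0 < i" "Suc i < length (Q u v)"
      "0 < j" "Suc j < length (Q x y)" for x y i j
    proof -
      have "interior (P {u, v}) \<inter> interior (P {x, y}) = {}"
        by (rule bspec[OF bspec[OF disj uv(4)] ends(4)[OF that(1)], THEN mp, OF that(2)])
      then show ?thesis
        using IntI[OF inn[OF that(3,4)], of "interior (P {x, y})"] inn[OF that(5,6)] by auto
    qed
  next
    show "V' = f ` V \<union> {Q u v ! i |u v i. adj E u v \<and> 0 < i \<and> Suc i < length (Q u v)}"
    proof -
      have "x \<in> (\<Union>e\<in>E. interior (P e)) \<longleftrightarrow>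
          x \<in> {Q u v ! i |u v i. adj E u v \<and> 0 < i \<and> Suc i < length (Q u v)}" for x
        unfolding un_int unfolding interior_nth by blast
      then show ?thesis
        unfolding V' by blast
    qed
    show "E' = {{Q u v ! i, Q u v ! Suc i} |u v i. adj E u v \<and> Suc i < length (Q u v)}"
    proof (rule set_eqI)
      show "x \<in> E' \<longleftrightarrow> x \<in> {{Q u v ! i, Q u v ! Suc i} |u v i. adj E u v \<and> Suc i < length (Q u v)}" for x
        unfolding E' un_edg unfolding list_edges_nth by blast
    qed
  qed
  then show ?thesis
    using that by blast
qed

section \<open>Vertices, neighbours and orientations of a subdivision\<close>

context subdivision
begin

lemma length_Q_commute: "adj E u v \<Longrightarrow> length (Q v u) = length (Q u v)"
  by (simp add: Q_rev)

lemma Q_reverse_nth: "adj E u v \<Longrightarrow> i < length (Q u v) \<Longrightarrow> Q v u ! i = Q u v ! (length (Q u v) - Suc i)"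
  by (simp add: Q_rev rev_nth)

lemma Q_last: 
  assumes "adj E u v" "Suc i = length (Q u v)"
  shows "Q u v ! i = f v"
proof -
  have "Q v u ! 0 = Q u v ! (length (Q u v) - Suc 0)"
    using Q_reverse_nth[OF assms(1), of 0] assms(2)[symmetric] by simp
  then show ?thesis
    using Q_first[OF adj_sym[OF assms(1)]] assms(2)[symmetric] by simp
qed

lemma Q_nth_eq_iff:
  "adj E u v \<Longrightarrow> i < length (Q u v) \<Longrightarrow> j < length (Q u v) \<Longrightarrow> Q u v ! i = Q u v ! j \<longleftrightarrow> i = j"
  using Q_distinct by (simp add: nth_eq_iff_index_eq)

lemma f_eq_iff: "u \<in> V \<Longrightarrow> v \<in> V \<Longrightarrow> f u = f v \<longleftrightarrow> u = v"
  using inj by (auto simp: inj_on_def)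

lemma Q_nth_eq_branch:
  assumes "adj E u v" "i < length (Q u v)" "z \<in> V"
  shows "Q u v ! i = f z \<longleftrightarrow> i = 0 \<and> z = u \<or> Suc i = length (Q u v) \<and> z = v"
proof -
  have uv: "u \<in> V" "v \<in> V" "u \<noteq> v"
    using adj_in_verts[OF g assms(1)] by auto
  consider "i = 0" | "Suc i = length (Q u v)" | "0 < i" "Suc i < length (Q u v)"
    using assms(2) by linarith
  then show ?thesis
  proof cases
    case 1
    then show ?thesis
      using Q_first[OF assms(1)] Q_length[OF assms(1)] f_eq_iff uv assms(3) by auto
  next
    case 2
    then show ?thesis
      using Q_last[OF assms(1) 2] Q_length[OF assms(1)] f_eq_iff uv assms(3) by auto
  next
    case 3
    then show ?thesis
      using Q_inner[OF assms(1) 3] assms(3) by auto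
  qed
qed

text \<open>Not being a branch vertex, the common vertex is inner in the second path as well. Inner
  parts belonging to distinct edges are disjoint, so only the two directions of one and the same
  path remain.\<close>

lemma Q_inner_nth_eq:
  assumes uv: "adj E u v" "0 < i" "Suc i < length (Q u v)" and xy: "adj E x y" "j < length (Q x y)"
    and eq: "Q u v ! i = Q x y ! j"
  shows "x = u \<and> y = v \<and> j = i \<or> x = v \<and> y = u \<and> j = length (Q u v) - Suc i"
proof -
  have V: "x \<in> V" "y \<in> V"
    using adj_in_verts[OF g xy(1)] by auto
  have "Q x y ! j \<noteq> f x" "Q x y ! j \<noteq> f y"
    using Q_inner[OF uv] eq V by auto
  then have "j \<noteq> 0" "Suc j \<noteq> length (Q x y)"
    using Q_nth_eq_branch[OF xy V(1)] Q_nth_eq_branch[OF xy V(2)] by auto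
  then have j: "0 < j" "Suc j < length (Q x y)"
    using xy by auto
  then have "{u, v} = {x, y}"
    using Q_disjoint[OF uv(1) xy(1) _ uv(2,3) j] eq by blast
  then consider "x = u" "y = v" | "x = v" "y = u"
    by (auto simp: doubleton_eq_iff)
  then show ?thesis
  proof cases
    case 1
    then show ?thesis
      using eq Q_nth_eq_iff[OF uv(1)] uv xy by auto
  next
    case 2
    then have "j < length (Q u v)"
      using xy length_Q_commute[OF uv(1)] by simp
    then have "Q u v ! i = Q u v ! (length (Q u v) - Suc j)"
      using eq Q_reverse_nth[OF uv(1)] 2 by simp
    then have "i = length (Q u v) - Suc j"
      using Q_nth_eq_iff[OF uv(1), of i "length (Q u v) - Suc j"] uv \<open>j < length (Q u v)\<close> by auto
    then show ?thesis
      using 2 \<open>j < length (Q u v)\<close> by auto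
  qed
qed

text \<open>One orientation of the step suffices, because the opposite one occurs on the reversed
  list \<open>Q v u\<close>.\<close>

lemma adj_subdivision_iff:
  "adj E' a b \<longleftrightarrow> (\<exists>u v i. adj E u v \<and> Suc i < length (Q u v) \<and> a = Q u v ! i \<and> b = Q u v ! Suc i)"
proof
  assume "adj E' a b"
  then obtain u v i where uv: "adj E u v" "Suc i < length (Q u v)" "{a, b} = {Q u v ! i, Q u v ! Suc i}"
    by (auto simp: adj_def E'_eq)
  then consider "a = Q u v ! i" "b = Q u v ! Suc i" | "a = Q u v ! Suc i" "b = Q u v ! i"
    by (auto simp: doubleton_eq_iff)
  then show "\<exists>u v i. adj E u v \<and> Suc i < length (Q u v) \<and> a = Q u v ! i \<and> b = Q u v ! Suc i"
  proof cases
    case 1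
    then show ?thesis
      using uv by blast
  next
    case 2
    define j where "j = length (Q u v) - Suc (Suc i)"
    have j: "Suc j < length (Q u v)" "length (Q u v) - Suc j = Suc i" "length (Q u v) - Suc (Suc j) = i"
      using uv by (auto simp: j_def)
    then have "a = Q v u ! j" "b = Q v u ! Suc j" "Suc j < length (Q v u)"
      using 2 Q_reverse_nth[OF uv(1)] length_Q_commute[OF uv(1)] by auto
    then show ?thesis
      using adj_sym[OF uv(1)] by blast
  qed
next
  assume "\<exists>u v i. adj E u v \<and> Suc i < length (Q u v) \<and> a = Q u v ! i \<and> b = Q u v ! Suc i"
  then obtain u v i where uv: "adj E u v" "Suc i < length (Q u v)" "a = Q u v ! i" "b = Q u v ! Suc i"
    by blast
  then have "a \<noteq> b"
    using Q_nth_eq_iff[OF uv(1), of i "Suc i"] by auto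
  then show "adj E' a b"
    using uv unfolding adj_def E'_eq by blast
qed

lemma Q_nth_in_V': "adj E u v \<Longrightarrow> i < length (Q u v) \<Longrightarrow> Q u v ! i \<in> V'"
proof -
  assume a: "adj E u v" "i < length (Q u v)"
  have uv: "u \<in> V" "v \<in> V"
    using adj_in_verts[OF g a(1)] by auto
  consider "i = 0" | "Suc i = length (Q u v)" | "0 < i" "Suc i < length (Q u v)"
    using a(2) by linarith
  then show ?thesis
  proof cases
    case 3
    then show ?thesis
      unfolding V'_eq using a(1) by blast
  qed (use uv Q_first[OF a(1)] Q_last[OF a(1)] in \<open>auto simp: V'_eq\<close>)
qed

lemma graph_subdivision: "graph V' E'"
proof -
  have "finite V"
    using g by (simp add: graph_def)
  moreover have "V' \<subseteq> f ` V \<union> (\<Union>(u, v)\<in>V \<times> V. set (Q u v))"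
    using adj_in_verts[OF g] unfolding V'_eq by fastforce
  ultimately have "finite V'"
    by (auto intro: finite_subset)
  moreover have "\<exists>a b. a \<in> V' \<and> b \<in> V' \<and> a \<noteq> b \<and> e = {a, b}" if "e \<in> E'" for e
  proof -
    obtain u v i where e: "adj E u v" "Suc i < length (Q u v)" "e = {Q u v ! i, Q u v ! Suc i}"
      using \<open>e \<in> E'\<close> unfolding E'_eq by blast
    then show ?thesis
      using Q_nth_in_V'[OF e(1), of i] Q_nth_in_V'[OF e(1), of "Suc i"] Q_nth_eq_iff[OF e(1), of i "Suc i"]
      by auto
  qed
  ultimately show ?thesis
    by (auto simp: graph_def)
qed

lemma inner_neighbours:
  assumes "adj E u v" "0 < i" "Suc i < length (Q u v)" "adj E' (Q u v ! i) b"
  shows "b = Q u v ! (i - 1) \<or> b = Q u v ! Suc i"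
proof -
  obtain x y j where x: "adj E x y" "Suc j < length (Q x y)" "Q u v ! i = Q x y ! j" "b = Q x y ! Suc j"
    using assms(4) unfolding adj_subdivision_iff by blast
  then consider "x = u" "y = v" "j = i" | "x = v" "y = u" "j = length (Q u v) - Suc i"
    using Q_inner_nth_eq[OF assms(1-3) x(1) _ x(3)] by auto
  then show ?thesis
  proof cases
    case 2
    then have "b = Q u v ! (length (Q u v) - Suc (Suc j))"
      using x Q_reverse_nth[OF assms(1), of "Suc j"] length_Q_commute[OF assms(1)] by simp
    moreover have "length (Q u v) - Suc (Suc j) = i - 1"
      using 2 assms by auto
    ultimately show ?thesis
      by simp
  qed (use x in auto)
qed

lemma branch_neighbours:
  assumes "u \<in> V" "adj E' (f u) b"
  shows "\<exists>v. adj E u v \<and> b = Q u v ! 1"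
proof -
  obtain x y j where x: "adj E x y" "Suc j < length (Q x y)" "f u = Q x y ! j" "b = Q x y ! Suc j"
    using assms(2) unfolding adj_subdivision_iff by blast
  then have "j = 0 \<and> x = u"
    using Q_nth_eq_branch[OF x(1), of j u] assms(1) by auto
  then show ?thesis
    using x by auto
qed

lemma branch_adj_branch:
  assumes "u \<in> V" "v \<in> V" "adj E' (f u) (f v)"
  shows "adj E u v \<and> length (Q u v) = 2"
proof -
  obtain w where w: "adj E u w" "f v = Q u w ! 1"
    using branch_neighbours assms by blast
  then have "Suc 1 = length (Q u w) \<and> v = w"
    using Q_nth_eq_branch[OF w(1), of 1 v] Q_length[OF w(1)] assms(2) by auto
  then show ?thesis
    using w by auto
qed

lemma inner_adj_branch:
  assumes "adj E u v" "0 < i" "Suc i < length (Q u v)" "adj E' (Q u v ! i) (f z)" "z \<in> V"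
  shows "i = 1 \<and> z = u \<or> Suc (Suc i) = length (Q u v) \<and> z = v"
proof -
  from inner_neighbours[OF assms(1-4)] show ?thesis
  proof
    assume "f z = Q u v ! (i - 1)"
    then show ?thesis
      using Q_nth_eq_branch[OF assms(1), of "i - 1" z] assms by fastforce
  next
    assume "f z = Q u v ! Suc i"
    then show ?thesis
      using Q_nth_eq_branch[OF assms(1), of "Suc i" z] assms by auto
  qed
qed

lemma V'_cases:
  assumes "a \<in> V'"
  obtains (branch) u where "u \<in> V" "a = f u"
  | (inner) u v i where "adj E u v" "0 < i" "Suc i < length (Q u v)" "a = Q u v ! i"
  using assms unfolding V'_eq by blast

text \<open>At an inner vertex of a triangle the two path neighbours would be adjacent. If one of
  them is inner too, its own neighbours are known and exclude this; otherwise both are branch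
  vertices whose edge is subdivided, hence nonadjacent. A triangle of branch vertices comes from one
  in the original graph.\<close>

lemma triangle_free_subdivision:
  assumes tf: "triangle_free V E"
  shows "triangle_free V' E'"
proof -
  have no_inner: False
    if uv: "adj E u v" "0 < i" "Suc i < length (Q u v)" and b: "adj E' (Q u v ! i) b"
      and c: "adj E' (Q u v ! i) c" and bc: "adj E' b c" for u v i b c
  proof -
    have V: "u \<in> V" "v \<in> V"
      using adj_in_verts[OF g uv(1)] by auto
    have "b \<noteq> c"
      using bc by (auto simp: adj_def)
    then have ends: "adj E' (Q u v ! (i - 1)) (Q u v ! Suc i)"
      using inner_neighbours[OF uv b] inner_neighbours[OF uv c] bc adj_sym[OF bc] by auto
    note eq = Q_nth_eq_iff[OF uv(1)]
    consider "0 < i - 1" | "Suc (Suc i) < length (Q u v)" | "i = 1" "length (Q u v) = 3"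
      using uv by linarith
    then show False
    proof cases
      case 1
      then have "Q u v ! Suc i = Q u v ! (i - 1 - 1) \<or> Q u v ! Suc i = Q u v ! Suc (i - 1)"
        using inner_neighbours[OF uv(1) 1 _ ends] uv by simp
      then show False
        using eq[of "Suc i" "i - 1 - 1"] eq[of "Suc i" "Suc (i - 1)"] uv by auto
    next
      case 2
      then have "Q u v ! (i - 1) = Q u v ! i \<or> Q u v ! (i - 1) = Q u v ! Suc (Suc i)"
        using inner_neighbours[OF uv(1) _ _ adj_sym[OF ends]] uv by simp
      then show False
        using eq[of "i - 1" i] eq[of "i - 1" "Suc (Suc i)"] uv 2 by auto
    next
      case 3
      then have "adj E' (f u) (f v)"
        using ends Q_first[OF uv(1)] Q_last[OF uv(1), of 2] by (simp add: numeral_2_eq_2)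
      then show False
        using branch_adj_branch[OF V] 3 by simp
    qed
  qed
  show ?thesis
    unfolding triangle_free_def
  proof
    assume "\<exists>x\<in>V'. \<exists>y\<in>V'. \<exists>z\<in>V'. adj E' x y \<and> adj E' y z \<and> adj E' x z"
    then obtain x y z where t: "x \<in> V'" "y \<in> V'" "z \<in> V'" "adj E' x y" "adj E' y z" "adj E' x z"
      by blast
    note t' = t(4-6) t(4-6)[THEN adj_sym]
    have "a \<in> f ` V" if a: "a \<in> V'" "adj E' a b" "adj E' a c" "adj E' b c" for a b c
      using a(1)
    proof (cases rule: V'_cases)
      case (inner u v i)
      then show ?thesis
        using no_inner a by blast
    qed auto
    then have "x \<in> f ` V" "y \<in> f ` V" "z \<in> f ` V"
      using t t' by blast+
    then obtain x' y' z' where "x' \<in> V" "y' \<in> V" "z' \<in> V" "x = f x'" "y = f y'" "z = f z'"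
      by blast
    then show False
      using t branch_adj_branch triangle_freeD[OF g tf] by blast
  qed
qed

text \<open>Each edge u -> v becomes a directed path. Branch vertices other than the pivot keep at
  most one in-edge and inner vertices get exactly one. The vertex just before the pivot is an old
  in-neighbour or an inner vertex; neither has another out-edge.\<close>

lemma orientation_subdivision:
  assumes po: "pivot_orientation V E q D rk"
  shows "\<exists>D' rk'. pivot_orientation V' E' (f q) D' rk'"
proof -
  have q: "q \<in> V" and DV: "\<And>u v. D u v \<Longrightarrow> u \<in> V \<and> v \<in> V \<and> rk u < rk v"
    and Dadj: "\<And>u v. u \<in> V \<Longrightarrow> v \<in> V \<Longrightarrow> adj E u v \<longleftrightarrow> D u v \<or> D v u"
    and Duniq: "\<And>u u' v. D u v \<Longrightarrow> D u' v \<Longrightarrow> v \<noteq> q \<Longrightarrow> u = u'"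
    and Dq: "\<And>u v. D u q \<Longrightarrow> D u v \<Longrightarrow> v = q" and Dq': "\<And>v. \<not> D q v"
    using po unfolding pivot_orientation_def by blast+
  have Da: "adj E u v" if "D u v" for u v
    using that DV[OF that] Dadj by blast
  define D' where "D' a b \<longleftrightarrow> (\<exists>u v i. D u v \<and> Suc i < length (Q u v) \<and> a = Q u v ! i \<and> b = Q u v ! Suc i)" for a b
  \<comment> \<open>N bounds the length of every path, so positions counted from
    \<open>N * rk u\<close> do not pass \<open>N * Suc (rk u)\<close>.\<close>
  define N where "N = (\<Sum>(u, v)\<in>V \<times> V. length (Q u v))"
  have N: "length (Q u v) \<le> N" if "D u v" for u v
  proof -
    have "finite (V \<times> V)"
      using g by (simp add: graph_def)
    then have "(case (u, v) of (u, v) \<Rightarrow> length (Q u v)) \<le> N"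
      unfolding N_def using DV[OF that] by (intro member_le_sum) auto
    then show ?thesis
      by simp
  qed
  \<comment> \<open>A relation first, as a vertex of the subdivision comes without a chosen u, v and
    i; that the value is unique is shown separately for branch and for inner vertices.\<close>
  define good where "good a n \<longleftrightarrow> (\<exists>u\<in>V. a = f u \<and> n = N * rk u) \<or>
    (\<exists>u v i. D u v \<and> 0 < i \<and> Suc i < length (Q u v) \<and> a = Q u v ! i \<and> n = N * rk u + i)" for a n
  define rk' where "rk' a = (SOME n. good a n)" for a
  have inner_eq: "x = u \<and> y = v \<and> j = i" if "D u v" "0 < i" "Suc i < length (Q u v)" "D x y" "j < length (Q x y)"
      "Q u v ! i = Q x y ! j" for u v x y i j
    using Q_inner_nth_eq[OF Da[OF that(1)] that(2,3) Da[OF that(4)] that(5,6)]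
      DV[OF that(1)] DV[OF that(4)] by auto
  have rk_branch: "rk' (f u) = N * rk u" if u: "u \<in> V" for u
    unfolding rk'_def
  proof (rule some_equality)
    show "good (f u) (N * rk u)"
      using u by (auto simp: good_def)
    fix n
    assume "good (f u) n"
    moreover have "f u \<noteq> Q x y ! i" if "D x y" "0 < i" "Suc i < length (Q x y)" for x y i
      using Q_inner[OF Da[OF that(1)] that(2,3)] u by (metis imageI)
    ultimately show "n = N * rk u"
      using f_eq_iff u unfolding good_def by auto
  qed
  have rk_inner: "rk' (Q u v ! i) = N * rk u + i" if uv: "D u v" "0 < i" "Suc i < length (Q u v)" for u v i
    unfolding rk'_def
  proof (rule some_equality)
    show "good (Q u v ! i) (N * rk u + i)"
      using uv by (auto simp: good_def)
    fix n
    assume "good (Q u v ! i) n"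
    then obtain x y j where "D x y" "0 < j" "Suc j < length (Q x y)" "Q u v ! i = Q x y ! j" "n = N * rk x + j"
      using Q_inner[OF Da[OF uv(1)] uv(2,3)] unfolding good_def by auto
    then show "n = N * rk u + i"
      using inner_eq[OF uv, of x y j] by auto
  qed
  have rk_init: "rk' (Q u v ! i) = N * rk u + i" if "D u v" "Suc i < length (Q u v)" for u v i
    using rk_inner[OF that(1) _ that(2)] rk_branch[of u] Q_first[OF Da[OF that(1)]] DV[OF that(1)]
    by (cases "i = 0") auto
  have rk_ge: "N * rk u + i \<le> rk' (Q u v ! i)" if uv: "D u v" "i < length (Q u v)" for u v i
  proof (cases "Suc i = length (Q u v)")
    case True
    have "N * Suc (rk u) \<le> N * rk v"
      using DV[OF uv(1)] by (intro mult_le_mono2) auto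
    then show ?thesis
      using Q_last[OF Da[OF uv(1)] True] rk_branch[of v] DV[OF uv(1)] N[OF uv(1)] uv(2) by simp
  next
    case False
    then show ?thesis
      using rk_init[OF uv(1), of i] uv(2) by simp
  qed
  have "pivot_orientation V' E' (f q) D' rk'"
    unfolding pivot_orientation_def
  proof (intro conjI allI impI ballI)
    show "f q \<in> V'"
      using q by (auto simp: V'_eq)
  next
    fix a b
    assume "D' a b"
    then obtain u v i where uv: "D u v" "Suc i < length (Q u v)" "a = Q u v ! i" "b = Q u v ! Suc i"
      unfolding D'_def by blast
    show "a \<in> V'" "b \<in> V'"
      using uv Q_nth_in_V'[OF Da[OF uv(1)]] by auto
    show "rk' a < rk' b"
      using rk_init[OF uv(1,2)] rk_ge[OF uv(1,2)] uv by simp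
  next
    fix a b
    have dir: "D' a b \<Longrightarrow> adj E' a b" for a b
      using Da unfolding D'_def adj_subdivision_iff by blast
    show "adj E' a b \<longleftrightarrow> D' a b \<or> D' b a"
    proof
      assume "adj E' a b"
      then obtain u v i where uv: "adj E u v" "Suc i < length (Q u v)" "a = Q u v ! i" "b = Q u v ! Suc i"
        unfolding adj_subdivision_iff by blast
      then consider "D u v" | "D v u"
        using Dadj[of u v] adj_in_verts[OF g uv(1)] by blast
      then show "D' a b \<or> D' b a"
      proof cases
        case 1
        then show ?thesis
          using uv unfolding D'_def by blast
      next
        case 2
        define j where "j = length (Q u v) - Suc (Suc i)"
        have j: "Suc j < length (Q u v)" "length (Q u v) - Suc j = Suc i" "length (Q u v) - Suc (Suc j) = i"
          using uv by (auto simp: j_def)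
        then have "b = Q v u ! j" "a = Q v u ! Suc j" "Suc j < length (Q v u)"
          using uv Q_reverse_nth[OF uv(1)] length_Q_commute[OF uv(1)] by auto
        then show ?thesis
          using 2 unfolding D'_def by blast
      qed
    next
      assume "D' a b \<or> D' b a"
      then show "adj E' a b"
        using dir[of a b] dir[of b a] adj_sym[of E' b a] by blast
    qed
  next
    fix a a' b
    assume "D' a b \<and> D' a' b \<and> b \<noteq> f q"
    then obtain u v i x y j where uv: "D u v" "Suc i < length (Q u v)" "a = Q u v ! i" "b = Q u v ! Suc i"
      and xy: "D x y" "Suc j < length (Q x y)" "a' = Q x y ! j" "b = Q x y ! Suc j" and b: "b \<noteq> f q"
      unfolding D'_def by blast
    have V: "u \<in> V" "v \<in> V"
      using DV[OF uv(1)] by auto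
    show "a = a'"
    proof (cases "Suc (Suc i) = length (Q u v)")
      case True
      then have "b = f v"
        using Q_last[OF Da[OF uv(1)] True] uv by simp
      then have "y = v" "Suc (Suc j) = length (Q x y)"
        using Q_nth_eq_branch[OF Da[OF xy(1)] xy(2) V(2)] xy by auto
      moreover have "v \<noteq> q"
        using b \<open>b = f v\<close> by auto
      ultimately have "x = u"
        using Duniq uv xy by blast
      then have "j = i"
        using \<open>y = v\<close> True \<open>Suc (Suc j) = length (Q x y)\<close> by simp
      then show ?thesis
        using uv xy \<open>y = v\<close> \<open>x = u\<close> by simp
    next
      case False
      then show ?thesis
        using inner_eq[OF uv(1) _ _ xy(1,2), of "Suc i"] uv xy by auto
    qed
  next
    fix a b
    assume "D' a (f q) \<and> D' a b"
    then obtain u v i x y j where uv: "D u v" "Suc i < length (Q u v)" "a = Q u v ! i" "f q = Q u v ! Suc i"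
      and xy: "D x y" "Suc j < length (Q x y)" "a = Q x y ! j" "b = Q x y ! Suc j"
      unfolding D'_def by blast
    have vq: "v = q" "Suc (Suc i) = length (Q u v)"
      using Q_nth_eq_branch[OF Da[OF uv(1)] uv(2) q] uv(4) by auto
    have V: "u \<in> V" "j < length (Q x y)"
      using DV[OF uv(1)] xy(2) by auto
    show "b = f q"
    proof (cases "i = 0")
      case True
      then have "a = f u"
        using uv Q_first[OF Da[OF uv(1)]] by simp
      then have "x = u" "j = 0"
        using Q_nth_eq_branch[OF Da[OF xy(1)] V(2) V(1)] xy by auto
      then have "y = q"
        using Dq uv(1) xy(1) vq by blast
      then show ?thesis
        using uv xy \<open>x = u\<close> \<open>j = 0\<close> True vq by simp
    next
      case False
      then show ?thesis
        using inner_eq[OF uv(1) _ uv(2) xy(1) V(2)] uv xy by auto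
    qed
  next
    fix b
    show "\<not> D' (f q) b"
    proof
      assume "D' (f q) b"
      then obtain u v i where uv: "D u v" "Suc i < length (Q u v)" "f q = Q u v ! i"
        unfolding D'_def by blast
      then have "u = q"
        using Q_nth_eq_branch[OF Da[OF uv(1)], of i q] q by auto
      then show False
        using Dq' uv by blast
    qed
  qed
  then show ?thesis
    by blast
qed

end

section \<open>Graphs without full star-cutsets\<close>

definition min_degree_two :: "'a set \<Rightarrow> 'a set set \<Rightarrow> bool" where
  "min_degree_two V E \<longleftrightarrow> (\<forall>u\<in>V. \<exists>v v'. v \<noteq> v' \<and> adj E u v \<and> adj E u v')"

lemma in_closed_nbhd: "graph V E \<Longrightarrow> x \<in> closed_nbhd V E w \<longleftrightarrow> x = w \<or> adj E w x"
  using adj_in_verts by (fastforce simp: closed_nbhd_def nbhd_def)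

text \<open>By triangle-freeness no neighbour of u is adjacent to q, so any neighbour other than q
  leads out of the star.\<close>

lemma second_neighbour_outside_star:
  assumes g: "graph V E" and tf: "triangle_free V E" and deg: "min_degree_two V E" and a: "adj E q u"
  shows "\<exists>v\<in>V - closed_nbhd V E q. adj E u v"
proof -
  have "u \<in> V"
    using adj_in_verts[OF g a] by simp
  then obtain v where v: "adj E u v" "v \<noteq> q"
    using deg unfolding min_degree_two_def by metis
  moreover have "\<not> adj E q v"
    using triangle_freeD[OF g tf a v(1)] .
  ultimately show ?thesis
    using adj_in_verts[OF g v(1)] in_closed_nbhd[OF g] by blast
qed

text \<open>The outside of the full star is connected, and each vertex of the star that survives has
  a neighbour there. Applied with A a single vertex and with A the two ends of an edge.\<close>

lemma connected_delete_within_star: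
  assumes g: "graph V E" and tf: "triangle_free V E" and deg: "min_degree_two V E"
    and nostar: "\<not> has_full_star_cutset V E" and q: "q \<in> A" "A \<subseteq> closed_nbhd V E q" "q \<in> V"
    and xy: "x \<in> V - A" "y \<in> V - A"
  shows "reachable (V - A) E x y"
proof -
  let ?N = "closed_nbhd V E q"
  have out: "\<exists>z\<in>V - ?N. reachable (V - A) E x z" if x: "x \<in> V - A" for x
  proof (cases "x \<in> ?N")
    case True
    then have a: "adj E q x"
      using in_closed_nbhd[OF g] x q by auto
    then obtain v where "v \<in> V - ?N" "adj E x v"
      using second_neighbour_outside_star[OF g tf deg] by blast
    then show ?thesis
      using x q by (blast intro: reachable_edge)
  qed (use x in \<open>auto intro: bexI[of _ x]\<close>)
  obtain x' y' where "x' \<in> V - ?N" "reachable (V - A) E x x'" "y' \<in> V - ?N" "reachable (V - A) E y y'"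
    using out xy by blast
  moreover have "reachable (V - A) E x' y'"
    using not_full_star_cutsetD[OF nostar q(3), of x' y'] calculation q(2) reachable_mono
    by (metis Diff_mono subset_refl)
  ultimately show ?thesis
    using reachable_sym reachable_trans by metis
qed

section \<open>Connectivity of star complements in a subdivision\<close>

context subdivision
begin

lemma reachable_segment:
  assumes uv: "adj E u v" and "i \<le> k" "k < length (Q u v)" "\<And>j. i \<le> j \<Longrightarrow> j \<le> k \<Longrightarrow> Q u v ! j \<notin> S"
  shows "reachable (V' - S) E' (Q u v ! i) (Q u v ! k)"
  using assms(2-4)
proof (induction k rule: dec_induct)
  case (step n)
  then have "reachable (V' - S) E' (Q u v ! i) (Q u v ! n)"
    by auto
  moreover have "adj E' (Q u v ! n) (Q u v ! Suc n)"
    using uv step unfolding adj_subdivision_iff by blast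
  then have "reachable (V' - S) E' (Q u v ! n) (Q u v ! Suc n)"
    using step Q_nth_in_V'[OF uv] by (intro reachable_edge) auto
  ultimately show ?case
    by (rule reachable_trans)
qed simp

lemma reachable_path:
  assumes uv: "adj E u v" "set (Q u v) \<inter> S = {}"
  shows "reachable (V' - S) E' (f u) (f v)"
proof -
  have len: "0 < length (Q u v)"
    using Q_length[OF uv(1)] by linarith
  have "reachable (V' - S) E' (Q u v ! 0) (Q u v ! (length (Q u v) - 1))"
  proof (rule reachable_segment[OF uv(1)])
    show "Q u v ! j \<notin> S" if "j \<le> length (Q u v) - 1" for j
    proof -
      have "j < length (Q u v)"
        using that len by linarith
      then show ?thesis
        using uv(2) nth_mem[of j "Q u v"] by blast
    qed
  qed (use len in auto)
  then show ?thesis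
    using Q_first[OF uv(1)] Q_last[OF uv(1), of "length (Q u v) - 1"] len by simp
qed

lemma Q_vertices:
  assumes "adj E u v" "a \<in> set (Q u v)"
  obtains "a = f u" | "a = f v" | i where "0 < i" "Suc i < length (Q u v)" "a = Q u v ! i"
proof -
  obtain i where i: "i < length (Q u v)" "a = Q u v ! i"
    using assms(2) by (auto simp: in_set_conv_nth)
  then consider "i = 0" | "Suc i = length (Q u v)" | "0 < i" "Suc i < length (Q u v)"
    by linarith
  then show thesis
    using i that Q_first[OF assms(1)] Q_last[OF assms(1)] by cases auto
qed

text \<open>A scheme for both kinds of stars: an inner vertex walks along its path to an end that
  survives, a surviving branch vertex in A leaves A along one intact path, and between branch
  vertices outside A the walks of the original graph are lifted.\<close>

lemma connected_outside:
  assumes conn: "\<And>u v. u \<in> V - A \<Longrightarrow> v \<in> V - A \<Longrightarrow> reachable (V - A) E u v"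
    and away: "\<And>u v. adj E u v \<Longrightarrow> u \<notin> A \<Longrightarrow> v \<notin> A \<Longrightarrow> set (Q u v) \<inter> S = {}"
    and exit: "\<And>u. u \<in> V \<Longrightarrow> u \<in> A \<Longrightarrow> f u \<notin> S \<Longrightarrow> \<exists>v\<in>V - A. adj E u v \<and> set (Q u v) \<inter> S = {}"
    and inner: "\<And>u v i. adj E u v \<Longrightarrow> 0 < i \<Longrightarrow> Suc i < length (Q u v) \<Longrightarrow> Q u v ! i \<notin> S \<Longrightarrow>
      (\<forall>j. i \<le> j \<longrightarrow> j < length (Q u v) \<longrightarrow> Q u v ! j \<notin> S) \<or> (\<forall>j\<le>i. Q u v ! j \<notin> S)"
    and a: "a \<in> V' - S" and b: "b \<in> V' - S"
  shows "reachable (V' - S) E' a b"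
proof -
  have lift: "reachable (V' - S) E' (f u) (f v)" if "u \<in> V - A" "v \<in> V - A" for u v
    using conn[OF that] unfolding reachable_def[of "V - A"]
  proof (induction rule: rtranclp_induct)
    case (step y z)
    then have "reachable (V' - S) E' (f y) (f z)"
      by (intro reachable_path away) auto
    then show ?case
      using step.IH reachable_trans by metis
  qed simp
  have branch: "\<exists>v\<in>V - A. reachable (V' - S) E' (f u) (f v)" if "u \<in> V" "f u \<notin> S" for u
  proof (cases "u \<in> A")
    case True
    then show ?thesis
      using exit[OF that(1) True that(2)] reachable_path by blast
  next
    case False
    then show ?thesis
      using that by (intro bexI[of _ u]) auto
  qed
  have to_branch: "\<exists>v\<in>V - A. reachable (V' - S) E' a (f v)" if a: "a \<in> V' - S" for a
  proof -
    have "a \<in> V'"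
      using a by blast
    then show ?thesis
    proof (cases rule: V'_cases)
      case (branch u)
      then show ?thesis
        using \<open>\<And>u. u \<in> V \<Longrightarrow> f u \<notin> S \<Longrightarrow> _\<close> a by blast
    next
      case (inner u v i)
      have uv: "u \<in> V" "v \<in> V"
        using adj_in_verts[OF g inner(1)] by auto
      have "\<exists>w\<in>V. f w \<notin> S \<and> reachable (V' - S) E' a (f w)"
        using assms(4)[OF inner(1-3)]
      proof
        show "Q u v ! i \<notin> S"
          using a inner by blast
      next
        assume *: "\<forall>j. i \<le> j \<longrightarrow> j < length (Q u v) \<longrightarrow> Q u v ! j \<notin> S"
        define k where "k = length (Q u v) - 1"
        have k: "i \<le> k" "k < length (Q u v)" "Suc k = length (Q u v)"
          using inner by (auto simp: k_def)
        have "reachable (V' - S) E' (Q u v ! i) (Q u v ! k)"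
          using * k by (intro reachable_segment[OF inner(1)]) auto
        then show ?thesis
          using Q_last[OF inner(1) k(3)] * k uv inner(4) by metis
      next
        assume *: "\<forall>j\<le>i. Q u v ! j \<notin> S"
        have "reachable (V' - S) E' (Q u v ! 0) (Q u v ! i)"
          using * inner by (intro reachable_segment[OF inner(1)]) auto
        then show ?thesis
          using Q_first[OF inner(1)] * uv inner(4) reachable_sym by (metis zero_le)
      qed
      then show ?thesis
        using \<open>\<And>u. u \<in> V \<Longrightarrow> f u \<notin> S \<Longrightarrow> _\<close> reachable_trans by metis
    qed
  qed
  show ?thesis
    using to_branch[OF a] to_branch[OF b] lift reachable_sym reachable_trans by metis
qed

text \<open>The star of a branch vertex f q is compared with the star of q; neighbours of q that
  survive because their edge is subdivided still have a way out. The star of an inner vertex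
  consists of three consecutive vertices of one path and is compared with the two ends of that edge,
  each of which has a further neighbour.\<close>

lemma star_complement_connected:
  assumes tf: "triangle_free V E" and deg: "min_degree_two V E"
    and nostar: "\<not> has_full_star_cutset V E" and w: "w \<in> V'"
    and ab: "a \<in> V' - closed_nbhd V' E' w" "b \<in> V' - closed_nbhd V' E' w"
  shows "reachable (V' - closed_nbhd V' E' w) E' a b"
  using w
proof (cases rule: V'_cases)
  case (branch q)
  define S where "S = closed_nbhd V' E' w"
  have S: "x \<in> S \<longleftrightarrow> x = f q \<or> adj E' (f q) x" for x
    unfolding S_def branch by (rule in_closed_nbhd[OF graph_subdivision])
  have inner_S: "u = q \<and> i = 1 \<or> v = q \<and> Suc (Suc i) = length (Q u v)"
    if "adj E u v" "0 < i" "Suc i < length (Q u v)" "Q u v ! i \<in> S" for u v i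
  proof -
    have "Q u v ! i \<noteq> f q"
      using Q_inner[OF that(1-3)] branch by auto
    then have "adj E' (Q u v ! i) (f q)"
      using that(4) S adj_sym by metis
    then show ?thesis
      using inner_adj_branch[OF that(1-3)] branch by auto
  qed
  have branch_S: "u = q \<or> adj E q u \<and> length (Q q u) = 2" if "u \<in> V" "f u \<in> S" for u
    using that S[of "f u"] branch_adj_branch[of q u] f_eq_iff[of u q] branch by auto
  have path_S: "set (Q u v) \<inter> S = {}" if "adj E u v" "u \<noteq> q" "v \<noteq> q" "f u \<notin> S" "f v \<notin> S" for u v
  proof -
    have "x \<notin> S" if "x \<in> set (Q u v)" for x
      using \<open>adj E u v\<close> \<open>x \<in> set (Q u v)\<close>
    proof (cases rule: Q_vertices)
      case (3 i)
      then show ?thesis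
        using inner_S[OF \<open>adj E u v\<close> 3(1,2)] \<open>u \<noteq> q\<close> \<open>v \<noteq> q\<close> by blast
    qed (use \<open>f u \<notin> S\<close> \<open>f v \<notin> S\<close> in auto)
    then show ?thesis
      by blast
  qed
  let ?A = "closed_nbhd V E q"
  have A: "x \<in> ?A \<longleftrightarrow> x = q \<or> adj E q x" for x
    by (rule in_closed_nbhd[OF g])
  have "reachable (V' - S) E' a b"
  proof (rule connected_outside[where A = ?A])
    show "reachable (V - ?A) E u v" if "u \<in> V - ?A" "v \<in> V - ?A" for u v
      using not_full_star_cutsetD[OF nostar branch(1) that] .
    show "set (Q u v) \<inter> S = {}" if "adj E u v" "u \<notin> ?A" "v \<notin> ?A" for u v
      using path_S[OF that(1)] that branch_S adj_in_verts[OF g that(1)] unfolding A by blast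
    show "\<exists>v\<in>V - ?A. adj E u v \<and> set (Q u v) \<inter> S = {}" if u: "u \<in> V" "u \<in> ?A" "f u \<notin> S" for u
    proof -
      have "u \<noteq> q"
        using u S by auto
      then have "adj E q u"
        using u A by auto
      then obtain v where v: "v \<in> V - ?A" "adj E u v"
        using second_neighbour_outside_star[OF g tf deg] by blast
      then have "f v \<notin> S" "v \<noteq> q"
        using branch_S[of v] A by auto
      then show ?thesis
        using path_S[OF v(2) \<open>u \<noteq> q\<close>] u v by blast
    qed
    show "(\<forall>j. i \<le> j \<longrightarrow> j < length (Q u v) \<longrightarrow> Q u v ! j \<notin> S) \<or> (\<forall>j\<le>i. Q u v ! j \<notin> S)"
      if uv: "adj E u v" "0 < i" "Suc i < length (Q u v)" "Q u v ! i \<notin> S" for u v i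
    proof (rule ccontr)
      assume "\<not> ?thesis"
      then obtain j k where j: "i \<le> j" "j < length (Q u v)" "Q u v ! j \<in> S"
        and k: "k \<le> i" "Q u v ! k \<in> S"
        by blast
      have V: "u \<in> V" "v \<in> V" "u \<noteq> v"
        using adj_in_verts[OF g uv(1)] by auto
      have "j \<noteq> i" "k \<noteq> i"
        using j k uv by auto
      then have jk: "i < j" "k < i"
        using j k by auto
      \<comment> \<open>A path blocked on both sides of i would have both ends in q or joined to q
        by unsubdivided edges. This gives a triangle, or an unsubdivided edge with an inner
        vertex.\<close>
      have "v = q \<or> f v \<in> S"
      proof (cases "Suc j = length (Q u v)")
        case True
        then show ?thesis
          using Q_last[OF uv(1) True] j by simp
      next
        case False
        then show ?thesis
          using inner_S[OF uv(1) _ _ j(3)] jk uv j(2) by auto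
      qed
      moreover have "u = q \<or> f u \<in> S"
      proof (cases "k = 0")
        case True
        then show ?thesis
          using Q_first[OF uv(1)] k by simp
      next
        case False
        then show ?thesis
          using inner_S[OF uv(1) _ _ k(2)] jk uv by auto
      qed
      ultimately have "v = q \<or> adj E q v \<and> length (Q q v) = 2" "u = q \<or> adj E q u \<and> length (Q q u) = 2"
        using branch_S V by blast+
      then show False
        using triangle_freeD[OF g tf, of q u v] uv V length_Q_commute[OF uv(1)] by auto
    qed
  qed (use ab S_def in auto)
  then show ?thesis
    by (simp add: S_def)
next
  case (inner x y k)
  define S where "S = closed_nbhd V' E' w"
  have xy: "x \<in> V" "y \<in> V" "x \<noteq> y"
    using adj_in_verts[OF g inner(1)] by auto
  have S: "a \<in> S \<longleftrightarrow> a = Q x y ! (k - 1) \<or> a = Q x y ! k \<or> a = Q x y ! Suc k" for a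
  proof
    assume "a \<in> S"
    then show "a = Q x y ! (k - 1) \<or> a = Q x y ! k \<or> a = Q x y ! Suc k"
      using inner_neighbours[OF inner(1-3), of a] in_closed_nbhd[OF graph_subdivision] inner(4)
      by (auto simp: S_def)
  next
    assume a: "a = Q x y ! (k - 1) \<or> a = Q x y ! k \<or> a = Q x y ! Suc k"
    have "adj E' (Q x y ! k) (Q x y ! Suc k)"
      using inner unfolding adj_subdivision_iff by blast
    moreover have "adj E' (Q x y ! (k - 1)) (Q x y ! Suc (k - 1))"
      unfolding adj_subdivision_iff using inner
      by (intro exI[of _ x] exI[of _ y] exI[of _ "k - 1"]) auto
    then have "adj E' (Q x y ! k) (Q x y ! (k - 1))"
      using inner adj_sym[of E'] by simp
    ultimately show "a \<in> S"
      using a in_closed_nbhd[OF graph_subdivision] inner(4) by (auto simp: S_def)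
  qed
  have S_ex: "\<exists>j. k - 1 \<le> j \<and> j \<le> Suc k \<and> j < length (Q x y) \<and> a = Q x y ! j" if "a \<in> S" for a
  proof -
    obtain j where "j \<in> {k - 1, k, Suc k}" "a = Q x y ! j"
      using \<open>a \<in> S\<close> S by blast
    then show ?thesis
      using inner by (intro exI[of _ j]) auto
  qed
  have S_idx: "Q x y ! j \<in> S \<longleftrightarrow> k - 1 \<le> j \<and> j \<le> Suc k" if "j < length (Q x y)" for j
  proof
    assume "Q x y ! j \<in> S"
    then show "k - 1 \<le> j \<and> j \<le> Suc k"
      using S_ex Q_nth_eq_iff[OF inner(1)] that by metis
  next
    assume "k - 1 \<le> j \<and> j \<le> Suc k"
    then have "j = k - 1 \<or> j = k \<or> j = Suc k"
      by linarith
    then show "Q x y ! j \<in> S"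
      using S by auto
  qed
  have branch_S: "u = x \<or> u = y" if u: "u \<in> V" "f u \<in> S" for u
  proof -
    obtain j where "j < length (Q x y)" "f u = Q x y ! j"
      using S_ex[OF u(2)] by blast
    then show ?thesis
      using Q_nth_eq_branch[OF inner(1), of j u] u by auto
  qed
  have inner_S: "u = x \<and> v = y \<and> k - 1 \<le> i \<and> i \<le> Suc k \<or>
      u = y \<and> v = x \<and> k - 1 \<le> length (Q u v) - Suc i \<and> length (Q u v) - Suc i \<le> Suc k"
    if i: "adj E u v" "0 < i" "Suc i < length (Q u v)" "Q u v ! i \<in> S" for u v i
  proof -
    obtain j where "k - 1 \<le> j" "j \<le> Suc k" "j < length (Q x y)" "Q u v ! i = Q x y ! j"
      using S_ex[OF i(4)] by blast
    then show ?thesis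
      using Q_inner_nth_eq[OF i(1-3) inner(1)] by auto
  qed
  have path_S: "set (Q u v) \<inter> S = {}" if "adj E u v" "{u, v} \<noteq> {x, y}" "f u \<notin> S" "f v \<notin> S" for u v
  proof -
    have "z \<notin> S" if "z \<in> set (Q u v)" for z
      using \<open>adj E u v\<close> \<open>z \<in> set (Q u v)\<close>
    proof (cases rule: Q_vertices)
      case (3 i)
      then show ?thesis
        using inner_S[OF \<open>adj E u v\<close> 3(1,2)] \<open>{u, v} \<noteq> {x, y}\<close> by blast
    qed (use \<open>f u \<notin> S\<close> \<open>f v \<notin> S\<close> in auto)
    then show ?thesis
      by blast
  qed
  have "reachable (V' - S) E' a b"
  proof (rule connected_outside[where A = "{x, y}"])
    show "reachable (V - {x, y}) E u v" if "u \<in> V - {x, y}" "v \<in> V - {x, y}" for u v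
    proof (rule connected_delete_within_star[OF g tf deg nostar])
      show "{x, y} \<subseteq> closed_nbhd V E x"
        using in_closed_nbhd[OF g] inner(1) by auto
    qed (use that xy in auto)
    show "set (Q u v) \<inter> S = {}" if "adj E u v" "u \<notin> {x, y}" "v \<notin> {x, y}" for u v
      using path_S[OF that(1)] that branch_S[of u] branch_S[of v] adj_in_verts[OF g that(1)] by blast
    show "\<exists>v\<in>V - {x, y}. adj E u v \<and> set (Q u v) \<inter> S = {}" if u: "u \<in> V" "u \<in> {x, y}" "f u \<notin> S" for u
    proof -
      obtain v where v: "adj E u v" "v \<notin> {x, y}"
        using deg u adj_in_verts[OF g] unfolding min_degree_two_def by (metis insertE insertI1 singletonD)
      then have "v \<in> V" "f v \<notin> S" "{u, v} \<noteq> {x, y}"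
        using branch_S[of v] adj_in_verts[OF g v(1)] by auto
      then show ?thesis
        using path_S[OF v(1)] u v by blast
    qed
    show "(\<forall>j. i \<le> j \<longrightarrow> j < length (Q u v) \<longrightarrow> Q u v ! j \<notin> S) \<or> (\<forall>j\<le>i. Q u v ! j \<notin> S)"
      if uv: "adj E u v" "0 < i" "Suc i < length (Q u v)" "Q u v ! i \<notin> S" for u v i
    proof (rule ccontr)
      assume "\<not> ?thesis"
      then obtain j l where j: "i \<le> j" "j < length (Q u v)" "Q u v ! j \<in> S"
        and l: "l \<le> i" "Q u v ! l \<in> S"
        by blast
      have V: "u \<in> V" "v \<in> V" "u \<noteq> v"
        using adj_in_verts[OF g uv(1)] by auto
      \<comment> \<open>On the path of w itself the removed positions are consecutive, so one side
        of i stays free. Any other path can only lose ends, and losing both would make it join x and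
        y.\<close>
      consider "u = x" "v = y" | "u = y" "v = x" | "{u, v} \<noteq> {x, y}"
        by (metis doubleton_eq_iff)
      then show False
      proof cases
        case 1
        then show False
          using S_idx[of i] S_idx[of j] S_idx[of l] uv j l by auto
      next
        case 2
        then have len: "length (Q x y) = length (Q u v)"
          using length_Q_commute[OF inner(1)] by simp
        have idx: "Q u v ! m \<in> S \<longleftrightarrow> k - 1 \<le> length (Q u v) - Suc m \<and> length (Q u v) - Suc m \<le> Suc k"
          if "m < length (Q u v)" for m
          using S_idx[of "length (Q u v) - Suc m"] Q_reverse_nth[OF inner(1), of m] that 2 len by simp
        show False
          using idx[of i] idx[of j] idx[of l] uv j l by auto
      next
        case 3
        have "j \<noteq> i" "l \<noteq> i"
          using j l uv by auto
        have "Suc j = length (Q u v)"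
          using inner_S[OF uv(1) _ _ j(3)] 3 j uv by fastforce
        then have "f v \<in> S"
          using Q_last[OF uv(1)] j by auto
        have "l = 0"
          using inner_S[OF uv(1) _ _ l(2)] 3 l uv by fastforce
        then have "f u \<in> S"
          using Q_first[OF uv(1)] l by auto
        then show False
          using \<open>f v \<in> S\<close> branch_S V 3 by blast
      qed
    qed
  qed (use ab S_def in auto)
  then show ?thesis
    by (simp add: S_def)
qed

end

section \<open>Cycles in restricted frame graphs\<close>

text \<open>The two intersections with the right side give all weak inequalities except the one
  between the left sides, and corners make them strict. If the left side of C were not to the right
  of that of B, the left side of B would hit the top of C.\<close>

lemma meeting_frames_cross:
  assumes "valid_box B" "valid_box C" "corners B \<inter> frame C = {}" "corners C \<inter> frame B = {}"
    "left_side B \<inter> frame C = {}"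
    "right_side B \<inter> top_side C \<noteq> {}" "right_side B \<inter> bottom_side C \<noteq> {}"
  shows "crosses B C"
proof -
  obtain a b c d where B: "B = (a, b, c, d)"
    by (cases B)
  obtain a' b' c' d' where C: "C = (a', b', c', d')"
    by (cases C)
  have ab: "a < b" "c < d" "a' < b'" "c' < d'"
    using assms(1,2) by (auto simp: B C valid_box_def)
  have le: "a' \<le> b" "b \<le> b'" "c \<le> d'" "d' \<le> d" "c \<le> c'" "c' \<le> d"
    using assms(6,7) by (auto simp: B C side_defs)
  have pB: "(b, c) \<notin> frame C" "(b, d) \<notin> frame C" and pC: "(a', d') \<notin> frame B" "(b', d') \<notin> frame B"
    using assms(3,4) by (auto simp: B C corners_def)
  have "b \<noteq> a'" "b \<noteq> b'"
    using pC le ab by (auto simp: B frame_eq)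
  moreover have "c \<noteq> c'" "d \<noteq> d'"
    using pB le ab by (auto simp: C frame_eq)
  moreover have "a < a'"
  proof (rule ccontr)
    assume "\<not> a < a'"
    then have "(a, d') \<in> left_side B" "(a, d') \<in> frame C"
      using le ab by (auto simp: B C left_side_def frame_eq)
    then show False
      using assms(5) by blast
  qed
  ultimately show ?thesis
    using le by (auto simp: B C)
qed

text \<open>Otherwise a common point lies on horizontal sides of both frames, at equal height. The
  box that ends first then has a right corner on the other frame.\<close>

lemma meeting_frames_right_side:
  assumes "valid_box B" "valid_box C" "corners B \<inter> frame C = {}" "corners C \<inter> frame B = {}"
    "left_side B \<inter> frame C = {}" "left_side C \<inter> frame B = {}" "frame B \<inter> frame C \<noteq> {}"
  shows "right_side B \<inter> frame C \<noteq> {} \<or> right_side C \<inter> frame B \<noteq> {}"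
proof (rule ccontr)
  assume none: "\<not> ?thesis"
  obtain a b c d where B: "B = (a, b, c, d)"
    by (cases B)
  obtain a' b' c' d' where C: "C = (a', b', c', d')"
    by (cases C)
  obtain x y where xy: "(x, y) \<in> frame B" "(x, y) \<in> frame C"
    using assms(7) by auto
  have "(x, y) \<notin> left_side B" "(x, y) \<notin> right_side B" "(x, y) \<notin> left_side C" "(x, y) \<notin> right_side C"
    using xy assms(5,6) none by blast+
  then have "(x, y) \<in> top_side B \<union> bottom_side B" "(x, y) \<in> top_side C \<union> bottom_side C"
    using xy by (auto simp: frame_def)
  then have y: "y = c \<or> y = d" "y = c' \<or> y = d'" and x: "a \<le> x" "x \<le> b" "a' \<le> x" "x \<le> b'"
    by (auto simp: B C side_defs)
  show False
  proof (cases "b \<le> b'")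
    case True
    then have "(b, y) \<in> corners B" "(b, y) \<in> frame C"
      using x y by (auto simp: B C corners_def frame_eq)
    then show False
      using assms(3) by blast
  next
    case False
    then have "(b', y) \<in> corners C" "(b', y) \<in> frame B"
      using x y by (auto simp: B C corners_def frame_eq)
    then show False
      using assms(4) by blast
  qed
qed

text \<open>A vertical side of one frame and a horizontal side of the other would meet in one of
  eight candidate points; excluding all of them leaves a problem of linear arithmetic.\<close>

lemma disjoint_frames_cases:
  assumes "valid_box B" "valid_box C" "frame B \<inter> frame C = {}"
  shows "separated B C \<or> inside B C \<or> inside C B"
proof -
  obtain a b c d where B: "B = (a, b, c, d)"
    by (cases B)
  obtain a' b' c' d' where C: "C = (a', b', c', d')"
    by (cases C)
  have ab: "a < b" "c < d" "a' < b'" "c' < d'"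
    using assms(1,2) by (auto simp: B C valid_box_def)
  have 1: "\<not> (a' \<le> x \<and> x \<le> b' \<and> c \<le> y \<and> y \<le> d)" if "x = a \<or> x = b" "y = c' \<or> y = d'" for x y
  proof
    assume "a' \<le> x \<and> x \<le> b' \<and> c \<le> y \<and> y \<le> d"
    then have "(x, y) \<in> frame B" "(x, y) \<in> frame C"
      using that by (auto simp: B C frame_eq)
    then show False
      using assms(3) by blast
  qed
  have 2: "\<not> (a \<le> x \<and> x \<le> b \<and> c' \<le> y \<and> y \<le> d')" if "x = a' \<or> x = b'" "y = c \<or> y = d" for x y
  proof
    assume "a \<le> x \<and> x \<le> b \<and> c' \<le> y \<and> y \<le> d'"
    then have "(x, y) \<in> frame B" "(x, y) \<in> frame C"
      using that by (auto simp: B C frame_eq)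
    then show False
      using assms(3) by blast
  qed
  show ?thesis
    using ab 1[of a c'] 1[of a d'] 1[of b c'] 1[of b d'] 2[of a' c] 2[of a' d] 2[of b' c] 2[of b' d]
    unfolding B C separated.simps inside.simps by argo
qed

text \<open>Being surrounded by W spreads along an edge: B shares points with A, so it is not
  outside W, and if it surrounded W it would surround A as well.\<close>

lemma inside_step:
  assumes "valid_box A" "valid_box B" "inside A W" "crosses A B \<or> crosses B A"
    "separated B W \<or> inside B W \<or> inside W B"
  shows "inside B W"
  using assms by (cases A; cases B; cases W) (auto simp: valid_box_def)

text \<open>Acyclicity is phrased through edge sets because these are easier to transfer to a subdivision
  than vertex lists.\<close>

definition forest_without :: "'a set set \<Rightarrow> 'a \<Rightarrow> bool" where
  "forest_without E p \<longleftrightarrow> (\<forall>F. F \<subseteq> E \<longrightarrow> F \<noteq> {} \<longrightarrow> p \<notin> \<Union>F \<longrightarrow>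
     (\<exists>e\<in>F. \<exists>v\<in>e. \<forall>u u'. {v, u} \<in> F \<longrightarrow> {v, u'} \<in> F \<longrightarrow> u = u'))"

text \<open>Two in-neighbours of a vertex are nested, and the surrounding frames form a clique, so that
  there are at most two of them.  Deleting the left one leaves in-degrees at most one; then the last
  vertex covered by an edge set lies on only one of its edges.\<close>

lemma restricted_frame_graph_pivot:
  assumes rfg: "restricted_frame_graph V E" and tf: "triangle_free V E" and ne: "V \<noteq> {}"
    and conn: "\<And>w x y. w \<in> V \<Longrightarrow> x \<in> V - closed_nbhd V E w \<Longrightarrow> y \<in> V - closed_nbhd V E w \<Longrightarrow>
      reachable (V - closed_nbhd V E w) E x y"
  shows "\<exists>p\<in>V. forest_without E p"
proof -
  from rfg obtain F where g: "graph V E" and valid: "\<And>v. v \<in> V \<Longrightarrow> valid_box (F v)"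
    and edges: "\<And>u v. u \<in> V \<Longrightarrow> v \<in> V \<Longrightarrow> u \<noteq> v \<Longrightarrow> {u, v} \<in> E \<longleftrightarrow> frame (F u) \<inter> frame (F v) \<noteq> {}"
    and corner: "\<And>u v. u \<in> V \<Longrightarrow> v \<in> V \<Longrightarrow> u \<noteq> v \<Longrightarrow> corners (F u) \<inter> frame (F v) = {}"
    and left: "\<And>u v. u \<in> V \<Longrightarrow> v \<in> V \<Longrightarrow> u \<noteq> v \<Longrightarrow> left_side (F u) \<inter> frame (F v) = {}"
    and right: "\<And>u v. u \<in> V \<Longrightarrow> v \<in> V \<Longrightarrow> u \<noteq> v \<Longrightarrow> right_side (F u) \<inter> frame (F v) \<noteq> {} \<Longrightarrow>
      right_side (F u) \<inter> top_side (F v) \<noteq> {} \<and> right_side (F u) \<inter> bottom_side (F v) \<noteq> {}"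
    unfolding restricted_frame_graph_def by (elim conjE exE) blast
  define X where "X u v \<longleftrightarrow> crosses (F u) (F v)" for u v
  define I where "I u v \<longleftrightarrow> inside (F u) (F v)" for u v
  have cross: "X u v \<or> X v u" if a: "adj E u v" for u v
  proof -
    have uv: "u \<in> V" "v \<in> V" "u \<noteq> v" "v \<noteq> u"
      using adj_in_verts[OF g a] by auto
    have "frame (F u) \<inter> frame (F v) \<noteq> {}"
      using a edges[OF uv(1-3)] by (simp add: adj_def)
    then consider "right_side (F u) \<inter> frame (F v) \<noteq> {}" | "right_side (F v) \<inter> frame (F u) \<noteq> {}"
      using meeting_frames_right_side[of "F u" "F v"] valid corner left uv by metis
    then show ?thesis
    proof cases
      case 1
      then show ?thesis
        using meeting_frames_cross[of "F u" "F v"] right[OF uv(1-3)] valid corner left uv by (metis X_def)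
    next
      case 2
      then show ?thesis
        using meeting_frames_cross[of "F v" "F u"] right[OF uv(2,1,4)] valid corner left uv by (metis X_def)
    qed
  qed
  have apart: "separated (F u) (F v) \<or> I u v \<or> I v u" if "u \<in> V" "v \<in> V" "u \<noteq> v" "\<not> adj E u v" for u v
    using disjoint_frames_cases[of "F u" "F v"] edges[of u v] that valid by (auto simp: adj_def I_def)
  have not_self: "\<not> I v v" for v
    by (cases "F v") (auto simp: I_def)
  have not_both: "\<not> (I u v \<and> I v u)" for u v
    by (cases "F u"; cases "F v") (auto simp: I_def)
  have inside_nonadj: "\<not> adj E u v" if "I u v" for u v
  proof
    assume "adj E u v"
    from cross[OF this] that show False
      by (cases "F u"; cases "F v") (auto simp: I_def X_def)
  qed
  \<comment> \<open>The complement of the star of w is connected, and \<open>inside_step\<close>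
    carries the property along its edges, starting from \<open>z0\<close>.\<close>
  have surround: "I z w" if w: "w \<in> V" "z0 \<in> V" "I z0 w" and z: "z \<in> V" "z \<noteq> w" "\<not> adj E w z" for w z0 z
  proof -
    let ?W = "V - closed_nbhd V E w"
    have "z0 \<in> ?W" "z \<in> ?W"
      using w z not_self inside_nonadj[OF w(3)] adj_sym[of E w z0] in_closed_nbhd[OF g] by auto
    then have r: "reachable ?W E z0 z"
      using conn w by blast
    have "z \<in> {z. I z w}"
    proof (rule reachable_closed_set[OF r])
      fix u v
      assume uv: "u \<in> ?W" "v \<in> ?W" "adj E u v" "u \<in> {z. I z w}"
      then have "v \<noteq> w" "\<not> adj E v w"
        using in_closed_nbhd[OF g, of v w] adj_sym[of E v w] by auto
      then have "separated (F v) (F w) \<or> I v w \<or> I w v"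
        using apart[of v w] uv w by blast
      then show "v \<in> {z. I z w}"
        using inside_step[of "F u" "F v" "F w"] uv valid cross[OF uv(3)] by (auto simp: I_def X_def)
    qed (use w in simp)
    then show ?thesis
      by simp
  qed
  define S where "S = {w \<in> V. \<exists>z\<in>V. I z w}"
  \<comment> \<open>Two nonadjacent surrounding frames would have to surround each other.\<close>
  have clique: "adj E w w'" if "w \<in> S" "w' \<in> S" "w \<noteq> w'" for w w'
    using that surround[of w _ w'] surround[of w' _ w] not_both[of w w'] adj_sym[of E w' w]
    by (auto simp: S_def)
  \<comment> \<open>The left side of v lies within both boxes, so they are not separated; since they
    are nonadjacent by triangle-freeness, one surrounds the other.\<close>
  have nested: "u \<in> S \<or> u' \<in> S" if uv: "X u v" "X u' v" "u \<noteq> u'" "adj E u v" "adj E u' v" for u u' v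
  proof -
    have V: "u \<in> V" "u' \<in> V"
      using adj_in_verts[OF g] uv by blast+
    have "\<not> adj E u u'"
      using triangle_freeD[OF g tf uv(4) adj_sym[OF uv(5)]] .
    moreover have "\<not> separated (F u) (F u')"
      using uv valid[OF V(1)] valid[OF V(2)] valid[of v] adj_in_verts[OF g uv(4)]
      by (cases "F u"; cases "F u'"; cases "F v") (auto simp: X_def valid_box_def)
    ultimately have "I u u' \<or> I u' u"
      using apart V uv by blast
    then show ?thesis
      using V by (auto simp: S_def)
  qed
  \<comment> \<open>A clique in a triangle-free graph has at most two vertices. If S has two, p is
    the one that crosses the other; if S is empty, p is arbitrary.\<close>
  obtain p where p: "p \<in> V" "\<And>w. w \<in> S \<Longrightarrow> w = p \<or> p \<in> S \<and> X p w"
  proof (cases "\<exists>w1\<in>S. \<exists>w2\<in>S. X w1 w2")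
    case True
    then obtain w1 w2 where w: "w1 \<in> S" "w2 \<in> S" "X w1 w2"
      by blast
    have "w1 \<noteq> w2"
      using w(3) by (cases "F w1") (auto simp: X_def)
    then have "w = w1 \<or> w = w2" if "w \<in> S" for w
      using clique w(1,2) that triangle_freeD[OF g tf] by metis
    then show ?thesis
      using that[of w1] w by (auto simp: S_def)
  next
    case False
    then have one: "w = w'" if "w \<in> S" "w' \<in> S" for w w'
      using clique[OF that] cross[of w w'] that by blast
    show ?thesis
    proof (cases "S = {}")
      case True
      then show ?thesis
        using ne that by blast
    next
      case False
      then obtain p where "p \<in> S"
        by blast
      then show ?thesis
        using that[of p] one by (auto simp: S_def)
    qed
  qed
  have unique: "u = u'" if uv: "adj E u v" "adj E u' v" "X u v" "X u' v" "u \<noteq> p" "u' \<noteq> p" "v \<noteq> p" for u u' v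
  \<comment> \<open>One of the two in-neighbours would be the second element w of S, crossed by p.
    Then v is not adjacent to p, hence surrounded by p. But w ends to the right of p, and v to the
    right of w.\<close>
  proof (rule ccontr)
    assume "u \<noteq> u'"
    then obtain w where w: "w \<in> S" "w \<noteq> p" "X w v" "adj E w v"
      using nested[OF uv(3,4)] uv by blast
    then have "p \<in> S" "X p w"
      using p by auto
    then obtain z0 where z0: "z0 \<in> V" "I z0 p"
      by (auto simp: S_def)
    have "adj E p w"
      using clique \<open>p \<in> S\<close> w by blast
    then have "\<not> adj E p v"
      using triangle_freeD[OF g tf] w by blast
    then have "I v p"
      using surround[OF p(1) z0] uv adj_in_verts[OF g uv(1)] by blast
    then show False
      using \<open>X p w\<close> w(3) by (cases "F p"; cases "F w"; cases "F v") (auto simp: X_def I_def)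
  qed
  have "forest_without E p"
    unfolding forest_without_def
  proof (intro allI impI)
    fix H
    assume H: "H \<subseteq> E" "H \<noteq> {}" "p \<notin> \<Union>H"
    have He: "e \<subseteq> V \<and> e \<noteq> {}" if "e \<in> H" for e
    proof -
      have "e \<in> E"
        using that H(1) by blast
      then obtain u v where "e = {u, v}" "adj E u v"
        using edge_is_adj[OF g] by blast
      then show ?thesis
        using adj_in_verts[OF g] by auto
    qed
    then have HV: "\<Union>H \<subseteq> V"
      by blast
    have fin: "finite (\<Union>H)"
      using finite_subset[OF HV] g by (simp add: graph_def)
    have "\<Union>H \<noteq> {}"
      using He H(2) by auto
    \<comment> \<open>The left abscissa increases along every crossing, so it orders the vertices
      topologically.\<close>
    define x where "x v = fst (F v)" for v
    have mono: "x u < x v" if "X u v" for u v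
      using that by (cases "F u"; cases "F v") (auto simp: X_def x_def)
    obtain v where v: "v \<in> \<Union>H" "\<And>u. u \<in> \<Union>H \<Longrightarrow> x u \<le> x v"
    proof -
      have "Max (x ` \<Union>H) \<in> x ` \<Union>H"
        using fin \<open>\<Union>H \<noteq> {}\<close> by (intro Max_in) auto
      then obtain v where "v \<in> \<Union>H" "Max (x ` \<Union>H) = x v"
        by (rule imageE)
      then show ?thesis
        using fin that[of v] Max_ge[OF finite_imageI[OF fin], of _ x] by (metis imageI)
    qed
    then obtain e where e: "e \<in> H" "v \<in> e"
      by blast
    have into: "X u v \<and> adj E u v \<and> u \<noteq> p" if vu: "{v, u} \<in> H" for u
    proof -
      have "{v, u} \<in> E"
        using vu H(1) by blast
      moreover have "v \<noteq> u"
        using \<open>{v, u} \<in> E\<close> g unfolding graph_def by fastforce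
      ultimately have "adj E u v"
        by (simp add: adj_def insert_commute)
      moreover have "u \<in> \<Union>H"
        using vu by blast
      then have "\<not> X v u"
        using v(2) mono by force
      moreover have "u \<noteq> p"
        using H(3) vu by blast
      ultimately show ?thesis
        using cross by blast
    qed
    moreover have "v \<noteq> p"
      using e H(3) by blast
    ultimately have "\<forall>u u'. {v, u} \<in> H \<longrightarrow> {v, u'} \<in> H \<longrightarrow> u = u'"
      using unique by blast
    then show "\<exists>e\<in>H. \<exists>v\<in>e. \<forall>u u'. {v, u} \<in> H \<longrightarrow> {v, u'} \<in> H \<longrightarrow> u = u'"
      using e by blast
  qed
  then show ?thesis
    using p(1) by blast
qed

section \<open>The characterization\<close>

lemma edge_adj: "graph V E \<Longrightarrow> {u, v} \<in> E \<Longrightarrow> adj E u v"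
  unfolding graph_def adj_def by fastforce

lemma has_cycle_delete_vertex: "has_cycle (V - {p}) {e \<in> E. p \<notin> e} \<longleftrightarrow> has_cycle (V - {p}) E"
proof -
  have "(\<forall>i. Suc i < length xs \<longrightarrow> adj {e \<in> E. p \<notin> e} (xs ! i) (xs ! Suc i)) \<and>
      adj {e \<in> E. p \<notin> e} (last xs) (hd xs) \<longleftrightarrow>
      (\<forall>i. Suc i < length xs \<longrightarrow> adj E (xs ! i) (xs ! Suc i)) \<and> adj E (last xs) (hd xs)"
    if xs: "set xs \<subseteq> V - {p}" "3 \<le> length xs" for xs
  proof -
    have "xs ! i \<noteq> p" if "i < length xs" for i
      using xs nth_mem[OF that] by blast
    moreover have "last xs \<noteq> p" "hd xs \<noteq> p"
      using xs last_in_set[of xs] hd_in_set[of xs] by fastforce+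
    ultimately show ?thesis
      unfolding adj_delete_vertex by auto
  qed
  then show ?thesis
    unfolding has_cycle_def by blast
qed

text \<open>If p is an inner vertex, an end of its edge takes its place as q: paths between vertices
  other than q then miss p. A cycle avoiding q lifts to the union of the paths of its edges, in
  which every vertex still lies on two edges.\<close>

lemma (in subdivision) acyclic_after_deletion:
  assumes p: "p \<in> V'"
    and forest: "forest_without E' p"
  shows "\<exists>q\<in>V. \<not> has_cycle (V - {q}) E"
proof -
  have "\<exists>q\<in>V. \<forall>u v i. adj E u v \<longrightarrow> u \<noteq> q \<longrightarrow> v \<noteq> q \<longrightarrow> i < length (Q u v) \<longrightarrow> Q u v ! i \<noteq> p"
    using p
  proof (cases rule: V'_cases)
    case (branch q)
    then show ?thesis
      using Q_nth_eq_branch by blast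
  next
    case (inner x y k)
    have "x \<in> V"
      using adj_in_verts[OF g inner(1)] by simp
    moreover have "Q u v ! i \<noteq> p" if "adj E u v" "u \<noteq> x" "v \<noteq> x" "i < length (Q u v)" for u v i
      using Q_inner_nth_eq[OF inner(1-3) that(1,4)] inner(4) that by auto
    ultimately show ?thesis
      by blast
  qed
  then obtain q where q: "q \<in> V"
    "\<And>u v i. adj E u v \<Longrightarrow> u \<noteq> q \<Longrightarrow> v \<noteq> q \<Longrightarrow> i < length (Q u v) \<Longrightarrow> Q u v ! i \<noteq> p"
    by blast
  have "\<not> has_cycle (V - {q}) E"
  proof
    assume "has_cycle (V - {q}) E"
    then obtain F where F: "F \<noteq> {}" "\<And>e. e \<in> F \<Longrightarrow> e \<in> E \<and> e \<subseteq> V - {q}"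
      "\<And>e v. e \<in> F \<Longrightarrow> v \<in> e \<Longrightarrow> \<exists>u u'. u \<noteq> u' \<and> {v, u} \<in> F \<and> {v, u'} \<in> F"
      by (rule cycle_two_edges_at_vertex) (assumption | rule that)+
    have Fadj: "adj E u v" "u \<noteq> q" "v \<noteq> q" "u \<in> V" "v \<in> V" if "{u, v} \<in> F" for u v
      using F(2)[OF that] edge_adj[OF g] by auto
    define F' where "F' = {{Q u v ! i, Q u v ! Suc i} | u v i. {u, v} \<in> F \<and> Suc i < length (Q u v)}"
    have F'I: "{Q u v ! i, Q u v ! Suc i} \<in> F'" if "{u, v} \<in> F" "Suc i < length (Q u v)" for u v i
      using that unfolding F'_def by blast
    have "F' \<subseteq> E'"
    proof
      fix e
      assume "e \<in> F'"
      then obtain u v i where "{u, v} \<in> F" "Suc i < length (Q u v)" "e = {Q u v ! i, Q u v ! Suc i}"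
        unfolding F'_def by blast
      then show "e \<in> E'"
        unfolding E'_eq using Fadj(1) by (intro CollectI exI[of _ u] exI[of _ v] exI[of _ i]) simp
    qed
    moreover have "F' \<noteq> {}"
    proof -
      obtain e where "e \<in> F"
        using F(1) by blast
      moreover obtain u v where "e = {u, v}"
        using edge_is_adj[OF g, of e] F(2)[OF \<open>e \<in> F\<close>] by auto
      ultimately have "{u, v} \<in> F"
        by simp
      then show ?thesis
        using F'I[of u v 0] Q_length[OF Fadj(1)] by force
    qed
    moreover have "p \<notin> e" if "e \<in> F'" for e
    proof -
      obtain u v i where uv: "{u, v} \<in> F" "Suc i < length (Q u v)" "e = {Q u v ! i, Q u v ! Suc i}"
        using \<open>e \<in> F'\<close> unfolding F'_def by blast
      then show ?thesis
        using q(2)[OF Fadj(1-3)[OF uv(1)], of i] q(2)[OF Fadj(1-3)[OF uv(1)], of "Suc i"] by auto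
    qed
    then have "p \<notin> \<Union>F'"
      by blast
    ultimately obtain e a where ea: "e \<in> F'" "a \<in> e"
      "\<forall>b b'. {a, b} \<in> F' \<longrightarrow> {a, b'} \<in> F' \<longrightarrow> b = b'"
      using forest unfolding forest_without_def by meson
    obtain u v i where uv: "{u, v} \<in> F" "i < length (Q u v)" "a = Q u v ! i"
      using ea(1,2) Suc_lessD unfolding F'_def by blast
    \<comment> \<open>At a branch vertex, the paths of two different edges of the cycle start with
      different edges.\<close>
    have two: False if z: "z \<in> {u, v}" "a = f z" for z
    proof -
      obtain y y' where y: "y \<noteq> y'" "{z, y} \<in> F" "{z, y'} \<in> F"
        using F(3)[OF uv(1) z(1)] by blast
      note zy = Fadj[OF y(2)] and zy' = Fadj[OF y(3)]
      have len: "1 < length (Q z y)" "1 < length (Q z y')"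
        using Q_length[OF zy(1)] Q_length[OF zy'(1)] by auto
      have "{a, Q z y ! 1} \<in> F'" "{a, Q z y' ! 1} \<in> F'"
        using F'I[OF y(2), of 0] F'I[OF y(3), of 0] len Q_first[OF zy(1)] Q_first[OF zy'(1)] z(2) by auto
      then have eq: "Q z y ! 1 = Q z y' ! 1"
        using ea(3) by blast
      show False
      proof (cases "Suc 1 = length (Q z y)")
        case True
        then have "Q z y' ! 1 = f y"
          using Q_last[OF zy(1) True] eq by simp
        then show False
          using Q_nth_eq_branch[OF zy'(1) len(2) zy(5)] y(1) by auto
      next
        case False
        then show False
          using Q_inner_nth_eq[OF zy(1) _ _ zy'(1) len(2) eq] len y(1) zy'(1) by (auto simp: adj_def)
      qed
    qed
    note uvadj = Fadj(1)[OF uv(1)]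
    consider "i = 0" | "Suc i = length (Q u v)" | "0 < i" "Suc i < length (Q u v)"
      using uv(2) by linarith
    then show False
    proof cases
      case 1
      then show False
        using two[of u] Q_first[OF uvadj] uv(3) by simp
    next
      case 2
      then show False
        using two[of v] Q_last[OF uvadj 2] uv(3) by simp
    next
      case 3
      then have "{a, Q u v ! (i - 1)} \<in> F'" "{a, Q u v ! Suc i} \<in> F'"
        using F'I[OF uv(1), of "i - 1"] F'I[OF uv(1), of i] uv(3) by (auto simp: insert_commute)
      then have "Q u v ! (i - 1) = Q u v ! Suc i"
        using ea(3) by blast
      moreover have "i - 1 < length (Q u v)"
        using 3 by linarith
      ultimately show False
        using Q_nth_eq_iff[OF uvadj, of "i - 1" "Suc i"] 3 by auto
    qed
  qed
  then show ?thesis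
    using q(1) by blast
qed

text \<open>Each structural property comes from one star. The star of q shows that a neighbour of q
  has a single neighbour in the tree; the star of a leaf, which is the leaf, its neighbour in the
  tree and q, shows that this neighbour has degree two. Conversely a leaf needs a second neighbour
  in the graph, which can only be q.\<close>

lemma luxury_chandelierI:
  assumes g: "graph V E" and tf: "triangle_free V E" and deg: "min_degree_two V E"
    and nostar: "\<not> has_full_star_cutset V E" and q: "q \<in> V" and acyc: "\<not> has_cycle (V - {q}) E"
  shows "luxury_chandelier V E"
proof -
  define T where "T = V - {q}"
  define ET where "ET = {e \<in> E. q \<notin> e}"
  have adjT: "adj ET u v \<longleftrightarrow> adj E u v \<and> u \<noteq> q \<and> v \<noteq> q" for u v
    unfolding ET_def by (rule adj_delete_vertex)
  have T: "u \<in> T \<longleftrightarrow> u \<in> V \<and> u \<noteq> q" for u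
    by (auto simp: T_def)
  have nbhdT: "nbhd T ET u = {v. adj E u v \<and> v \<noteq> q}" if "u \<noteq> q" for u
    using that adj_in_verts[OF g, of u] by (auto simp: nbhd_def T adjT)
  have N: "x \<in> closed_nbhd V E w \<longleftrightarrow> x = w \<or> adj E w x" for x w
    by (rule in_closed_nbhd[OF g])
  have two: "\<exists>v. adj E u v \<and> v \<noteq> w" if "u \<in> V" for u w
    using deg that unfolding min_degree_two_def by metis
  \<comment> \<open>Outside the star of w the vertices y and y' are joined, by a walk that avoids x
    and q. If they were distinct, this would give a cycle through x that misses q.\<close>
  have no_detour: "y = y'" if y: "adj E x y" "adj E x y'" "x \<noteq> q" "w \<in> V" "x \<in> closed_nbhd V E w"
      "q \<in> closed_nbhd V E w" "y \<notin> closed_nbhd V E w" "y' \<notin> closed_nbhd V E w" for x y y' w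
  proof (rule ccontr)
    assume "y \<noteq> y'"
    have V: "x \<in> V" "y \<in> V" "y' \<in> V"
      using adj_in_verts[OF g] y by blast+
    have "reachable (V - closed_nbhd V E w) E y y'"
      using y V by (intro not_full_star_cutsetD[OF nostar]) auto
    then have "reachable (T - {x}) E y y'"
      by (rule reachable_mono) (use y in \<open>auto simp: T\<close>)
    moreover have "y' \<in> T" "x \<in> T"
      using y V by (auto simp: T)
    ultimately have "has_cycle T E"
      using has_cycle_through[of x T y' y E] y \<open>y \<noteq> y'\<close> adj_sym by metis
    then show False
      using acyc by (simp add: T_def)
  qed
  have "connected_graph T ET"
  proof -
    obtain v where "adj E q v"
      using two[OF q] by blast
    then have "v \<in> T"
      using adj_in_verts[OF g] by (auto simp: T)
    then have "T \<noteq> {}"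
      by blast
    moreover have "reachable T ET u v" if "u \<in> T" "v \<in> T" for u v
    proof -
      have "reachable (V - {q}) E u v"
        using that q by (intro connected_delete_within_star[OF g tf deg nostar, of q]) (auto simp: T N)
      then show ?thesis
        using reachable_delete_edges[of V "{q}" E u v] by (simp add: T_def ET_def)
    qed
    ultimately show ?thesis
      by (simp add: connected_graph_def)
  qed
  moreover have "graph T ET"
    using g unfolding graph_def T_def ET_def by blast
  moreover have "\<not> has_cycle T ET"
    using acyc unfolding T_def ET_def has_cycle_delete_vertex .
  ultimately have tree: "is_tree T ET"
    by (simp add: is_tree_def)
  have nbhd_q: "nbhd V E q = leaves T ET"
  proof (intro set_eqI iffI)
    fix x
    assume "x \<in> nbhd V E q"
    then have x: "x \<in> V" "adj E q x" "x \<noteq> q"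
      by (auto simp: nbhd_def adj_def)
    obtain y where y: "adj E x y" "y \<noteq> q"
      using two[OF x(1)] by blast
    have "y' \<notin> closed_nbhd V E q" if "adj E x y'" "y' \<noteq> q" for y'
      using triangle_freeD[OF g tf x(2) that(1)] that(2) by (simp add: N)
    then have "y' = y" if "adj E x y'" "y' \<noteq> q" for y'
      using no_detour[OF that(1) y(1) x(3) q] that y x(2) by (simp add: N)
    then have "nbhd T ET x = {y}"
      unfolding nbhdT[OF x(3)] using y by blast
    then show "x \<in> leaves T ET"
      using x by (simp add: leaves_def degree_def T)
  next
    fix x
    assume "x \<in> leaves T ET"
    then have x: "x \<in> V" "x \<noteq> q" "card (nbhd T ET x) = 1"
      by (auto simp: leaves_def degree_def T)
    then obtain y where "nbhd T ET x = {y}"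
      by (auto simp: card_1_singleton_iff)
    then have "v = y \<or> v = q" if "adj E x v" for v
      using that nbhdT[OF x(2)] by auto
    then have "adj E x q"
      using two[OF x(1), of y] by blast
    then show "x \<in> nbhd V E q"
      using x adj_sym by (auto simp: nbhd_def)
  qed
  have "degree T ET w = 2" if l: "l \<in> leaves T ET" and w: "w \<in> nbhd T ET l" for l w
  proof -
    have lq: "adj E q l" "l \<noteq> q"
      using l nbhd_q by (auto simp: nbhd_def adj_def)
    have lw: "adj E l w" "w \<noteq> q" "w \<in> V"
      using w by (auto simp: nbhd_def adjT T)
    have "card (nbhd T ET l) = 1"
      using l by (simp add: leaves_def degree_def)
    then have "nbhd T ET l = {w}"
      using w by (auto simp: card_1_singleton_iff)
    then have Nl: "x \<in> closed_nbhd V E l \<longleftrightarrow> x = l \<or> x = q \<or> x = w" for x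
      using nbhdT[OF lq(2)] lq lw adj_sym[OF lq(1)] unfolding N by auto
    have wq: "\<not> adj E w q"
      using triangle_freeD[OF g tf lq(1) lw(1)] adj_sym[of E w q] by blast
    obtain y where y: "adj E w y" "y \<noteq> l"
      using two[OF lw(3)] by blast
    have "y' = y" if "adj E w y'" "y' \<noteq> l" for y'
    proof -
      have "y \<noteq> w" "y' \<noteq> w" "y \<noteq> q" "y' \<noteq> q"
        using y that wq by (auto simp: adj_def)
      moreover have "l \<in> V"
        using adj_in_verts[OF g lw(1)] by simp
      ultimately show ?thesis
        using no_detour[OF that(1) y(1) lw(2), of l] Nl y that by auto
    qed
    then have "nbhd T ET w = {l, y}"
      unfolding nbhdT[OF lw(2)] using y adj_sym[OF lw(1)] lq wq by blast
    then show ?thesis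
      using y by (simp add: degree_def)
  qed
  moreover have "chandelier_pivot V E q"
    using q tree nbhd_q by (simp add: chandelier_pivot_def T_def ET_def)
  ultimately show ?thesis
    using g unfolding luxury_chandelier_def Let_def T_def ET_def by blast
qed

lemma path_graphI:
  assumes g: "graph V E" and "xs \<noteq> []" "distinct xs" "set xs = V"
    and adj: "\<And>u v. adj E u v \<longleftrightarrow> {u, v} \<in> list_edges xs"
  shows "is_path_graph V E"
proof -
  have "e \<in> E \<longleftrightarrow> e \<in> list_edges xs" for e
  proof
    assume "e \<in> E"
    then obtain u v where "e = {u, v}" "adj E u v"
      using edge_is_adj[OF g] by blast
    then show "e \<in> list_edges xs"
      using adj[of u v] by simp
  next
    assume e: "e \<in> list_edges xs"
    then obtain i where i: "e = {xs ! i, xs ! Suc i}"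
      by (auto simp: list_edges_nth)
    then have "adj E (xs ! i) (xs ! Suc i)"
      using adj e by simp
    then show "e \<in> E"
      using i by (simp add: adj_def)
  qed
  then show ?thesis
    unfolding is_path_graph_def using assms by blast
qed

text \<open>Two stars determine the graph. With y of degree one, x its neighbour and z a further
  neighbour of x, the star of z cuts off y, so every vertex besides y lies in that star. If z had
  two neighbours besides x, the star of one of them would isolate the other while y remains.\<close>

lemma low_degree_imp_path:
  assumes g: "graph V E" and conn: "connected_graph V E" and tf: "triangle_free V E"
    and nostar: "\<not> has_full_star_cutset V E" and low: "\<not> min_degree_two V E"
  shows "is_path_graph V E \<and> card V \<le> 4"
proof -
  obtain y where y: "y \<in> V" "\<And>v v'. adj E y v \<Longrightarrow> adj E y v' \<Longrightarrow> v = v'"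
    using low unfolding min_degree_two_def by blast
  have N: "x \<in> closed_nbhd V E w \<longleftrightarrow> x = w \<or> adj E w x" for x w
    by (rule in_closed_nbhd[OF g])
  have adjV: "u \<in> V \<and> v \<in> V \<and> u \<noteq> v" if "adj E u v" for u v
    using adj_in_verts[OF g that] .
  have closed: "V \<subseteq> C" if "y \<in> C" "\<And>u v. adj E u v \<Longrightarrow> u \<in> C \<Longrightarrow> v \<in> C" for C
  proof
    fix u
    assume "u \<in> V"
    then have "reachable V E y u"
      using conn y(1) by (auto simp: connected_graph_def)
    then show "u \<in> C"
      by (rule reachable_closed_set) (use that in auto)
  qed
  show ?thesis
  proof (cases "\<exists>x. adj E y x")
    case False
    then have V: "V = {y}"
      using closed[of "{y}"] y(1) by blast
    have "\<not> adj E u v" for u v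
      using adjV[of u v] V by auto
    then have "is_path_graph V E"
      by (intro path_graphI[OF g, of "[y]"]) (simp_all add: V list_edges_def)
    then show ?thesis
      by (simp add: V)
  next
    case True
    then obtain x where x: "adj E y x"
      by blast
    have yx: "v = x" if "adj E y v" for v
      using y(2)[OF that x] .
    show ?thesis
    proof (cases "\<exists>z. z \<noteq> y \<and> adj E x z")
      case False
      have V: "V = {y, x}"
      proof
        show "V \<subseteq> {y, x}"
          using False yx by (intro closed) auto
      qed (use adjV[OF x] in auto)
      have "adj E u v \<longleftrightarrow> {u, v} = {y, x}" for u v
        using adjV[of u v] x adj_sym[OF x] V by (auto simp: doubleton_eq_iff)
      then have "is_path_graph V E"
        using adjV[OF x] by (intro path_graphI[OF g, of "[y, x]"]) (simp_all add: V list_edges_def insert_commute)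
      then show ?thesis
        using adjV[OF x] by (simp add: V)
    next
      case True
      then obtain z where z: "z \<noteq> y" "adj E x z"
        by blast
      have zx: "adj E z x" "x \<noteq> z" "y \<noteq> x"
        using adj_sym[OF z(2)] adjV[OF z(2)] adjV[OF x] by auto
      have nzy: "\<not> adj E z y"
        using yx[of z] adj_sym[of E z y] zx by auto
      have V: "u = y \<or> u = z \<or> adj E z u" if "u \<in> V" for u
      proof (rule ccontr)
        assume u: "\<not> ?thesis"
        then have r: "reachable (V - closed_nbhd V E z) E y u"
          using that y(1) z nzy adjV[OF z(2)] by (intro not_full_star_cutsetD[OF nostar]) (auto simp: N)
        \<comment> \<open>The only neighbour x of y has been deleted with the star of z, so nothing
          else is reachable from y.\<close>
        have "u \<in> {y}"
          by (rule reachable_closed_set[OF r]) (use yx zx in \<open>auto simp: N\<close>)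
        then show False
          using u by simp
      qed
      have indep: "\<not> adj E u v" if "adj E z u" "adj E z v" for u v
        using triangle_freeD[OF g tf adj_sym[OF that(1)] that(2)] .
      have edges: "adj E u v \<longleftrightarrow> u = z \<and> adj E z v \<or> v = z \<and> adj E z u \<or> u = y \<and> v = x \<or> u = x \<and> v = y" for u v
      proof
        assume a: "adj E u v"
        show "u = z \<and> adj E z v \<or> v = z \<and> adj E z u \<or> u = y \<and> v = x \<or> u = x \<and> v = y"
          using V[of u] V[of v] adjV[OF a] a adj_sym[OF a] yx[of u] yx[of v] indep[of u v] by auto
      next
        assume "u = z \<and> adj E z v \<or> v = z \<and> adj E z u \<or> u = y \<and> v = x \<or> u = x \<and> v = y"
        then show "adj E u v"
          using x adj_sym[OF x] adj_sym[of E z u] by auto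
      qed
      show ?thesis
      proof (cases "\<exists>x'. x' \<noteq> x \<and> adj E z x'")
        case False
        then have Vz: "V = {y, x, z}"
          using V y(1) adjV[OF z(2)] by auto
        have "adj E u v \<longleftrightarrow> {u, v} = {y, x} \<or> {u, v} = {x, z}" for u v
          using edges[of u v] False zx by (auto simp: doubleton_eq_iff)
        then have "is_path_graph V E"
          using zx z by (intro path_graphI[OF g, of "[y, x, z]"]) (simp_all add: Vz list_edges_def)
        then show ?thesis
          using zx z by (simp add: Vz)
      next
        case True
        then obtain x' where x': "x' \<noteq> x" "adj E z x'"
          by blast
        have only: "u = x \<or> u = x'" if u: "adj E z u" for u
        proof (rule ccontr)
          assume ne: "\<not> ?thesis"
          have "x' \<noteq> y" "x' \<noteq> z"
            using x' nzy adjV[OF x'(2)] by auto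
          \<comment> \<open>The vertex x' has no neighbour but z, so its star is small enough to
            leave y in place and yet isolate u.\<close>
          then have Nx': "v \<in> closed_nbhd V E x' \<longleftrightarrow> v = x' \<or> v = z" for v
            using edges[of x' v] x' by (auto simp: N)
          have "u \<noteq> y" "u \<noteq> z"
            using u nzy adjV[OF u] by auto
          have "reachable (V - closed_nbhd V E x') E u y"
            using ne adjV[OF u] adjV[OF x'(2)] y(1) z(1) \<open>x' \<noteq> y\<close> \<open>u \<noteq> z\<close>
            by (intro not_full_star_cutsetD[OF nostar]) (auto simp: Nx')
          then have "y \<in> {u}"
          proof (rule reachable_closed_set)
            show "b \<in> {u}" if "b \<in> V - closed_nbhd V E x'" "adj E a b" "a \<in> {u}" for a b
              using that edges[of u b] ne \<open>u \<noteq> y\<close> \<open>u \<noteq> z\<close> Nx'[of b] by auto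
          qed simp
          then show False
            using \<open>u \<noteq> y\<close> by simp
        qed
        have Vz: "V = {y, x, z, x'}"
          using V only y(1) adjV[OF z(2)] adjV[OF x'(2)] by blast
        have "x' \<noteq> y" "x' \<noteq> z"
          using x' nzy adjV[OF x'(2)] by auto
        have "adj E u v \<longleftrightarrow> {u, v} = {y, x} \<or> {u, v} = {x, z} \<or> {u, v} = {z, x'}" for u v
          using edges[of u v] only[of u] only[of v] zx x' by (auto simp: doubleton_eq_iff)
        then have "is_path_graph V E"
          using zx z x' \<open>x' \<noteq> y\<close> \<open>x' \<noteq> z\<close>
          by (intro path_graphI[OF g, of "[y, x, z, x']"]) (simp_all add: Vz list_edges_def)
        moreover have "card V = 4"
          using zx z x' \<open>x' \<noteq> y\<close> \<open>x' \<noteq> z\<close> by (simp add: Vz)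
        ultimately show ?thesis
          by simp
      qed
    qed
  qed
qed

theorem theorem3p3:
  fixes V :: "'a set" and E :: "'a set set" and V' :: "'b set" and E' :: "'b set set"
  assumes "graph V E"
    and "connected_graph V E"
    and "triangle_free V E"
    and "\<not> has_full_star_cutset V E"
    and "subdivision_of V' E' V E"
  shows "restricted_frame_graph V' E' \<longleftrightarrow>
           ((is_path_graph V E \<and> card V \<le> 4) \<or> luxury_chandelier V E)"
proof -
  obtain f Q where "subdivision V E V' E' f Q"
    using subdivision_ofE[OF assms(5)] .
  then interpret subdivision V E V' E' f Q .
  show ?thesis
  proof
    assume rfg: "restricted_frame_graph V' E'"
    show "(is_path_graph V E \<and> card V \<le> 4) \<or> luxury_chandelier V E"
    proof (cases "min_degree_two V E")
      case False
      then show ?thesis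
        using low_degree_imp_path[OF assms(1-4)] by blast
    next
      case True
      have ne: "V' \<noteq> {}"
        using assms(2) by (auto simp: connected_graph_def V'_eq)
      obtain p where "p \<in> V'" "forest_without E' p"
        using restricted_frame_graph_pivot[OF rfg triangle_free_subdivision[OF assms(3)] ne]
          star_complement_connected[OF assms(3) True assms(4)] by blast
      then obtain q where "q \<in> V" "\<not> has_cycle (V - {q}) E"
        using acyclic_after_deletion by blast
      then show ?thesis
        using luxury_chandelierI[OF assms(1,3) True assms(4)] by blast
    qed
  next
    assume "(is_path_graph V E \<and> card V \<le> 4) \<or> luxury_chandelier V E"
    then obtain q D rk where "pivot_orientation V E q D rk"
      using path_graph_orientation[of V E] chandelier_orientation[OF assms(1,3)]
      unfolding luxury_chandelier_def by blast
    then obtain D' rk' where "pivot_orientation V' E' (f q) D' rk'"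
      using orientation_subdivision by blast
    then show "restricted_frame_graph V' E'"
      by (rule pivot_orientation_imp_restricted_frame_graph[OF graph_subdivision])
  qed
qed

end
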